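(* Let $1\le k\le n$. For a real symmetric $(n+1)\times(n+1)$ matrix $R=(r_{ij})_{0\le i,j\le n}$, write $r=(r_{ij})_{1\le i,j\le n}$, $x=(r_{01},\dots,r_{0n})$, and $$F_k(R)=r_{00}\,\sigma_k(r)-x\,T_{k-1}(r)\,x^T.$$ Let $\mathcal S=\{R: r\in\Gamma_k^+,\ F_k(R)>0\}$. Then $\mathcal S$ is a convex cone and $F_k^{1/(k+1)}$ is concave on $\mathcal S$; consequently $\log F_k$ is also concave on $\mathcal S$.
   Context: For a real symmetric $n\times n$ matrix $r$, $\sigma_j(r)$ is the $j$-th elementary symmetric function of its eigenvalues ($\sigma_0=1$), $\Gamma_k^+=\{r:\sigma_j(r)>0,\ 1\le j\le k\}$, and the Newton transformation is $T_{j}(r)=\sum_{i=0}^{j}(-1)^i\sigma_{j-i}(r)r^i$. *)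

theory Defs
  imports "HOL-Analysis.Analysis" "HOL-Computational_Algebra.Polynomial"
begin

definition charpoly :: "real^'n^'n \<Rightarrow> real poly" where
  "charpoly r = det (\<chi> i j. (if i = j then [:0, 1:] else 0) - [:r $ i $ j:])"

definition eigvals :: "real^'n^'n \<Rightarrow> ('n \<Rightarrow> real)" where
  "eigvals r = (SOME lam. charpoly r = (\<Prod>i\<in>UNIV. [:- lam i, 1:]))"

definition sigma :: "nat \<Rightarrow> real^'n^'n \<Rightarrow> real" where
  "sigma j r = (\<Sum>I\<in>{I. card I = j}. \<Prod>i\<in>I. eigvals r i)"

definition Gamma_plus :: "nat \<Rightarrow> (real^'n^'n) set" where
  "Gamma_plus k = {r. \<forall>j. 1 \<le> j \<and> j \<le> k \<longrightarrow> sigma j r > 0}"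

fun mpow :: "real^'n^'n \<Rightarrow> nat \<Rightarrow> real^'n^'n" where
  "mpow r 0 = mat 1"
| "mpow r (Suc i) = r ** mpow r i"

definition newton_T :: "nat \<Rightarrow> real^'n^'n \<Rightarrow> real^'n^'n" where
  "newton_T j r = (\<Sum>i\<in>{0..j}. ((-1) ^ i * sigma (j - i) r) *\<^sub>R mpow r i)"

text \<open>Blocks of an (n+1)x(n+1) matrix indexed by 'n option; None plays the role of index 0.\<close>
definition blk_r :: "real^('n::finite option)^('n option) \<Rightarrow> real^'n^'n" where
  "blk_r R = (\<chi> i j. R $ Some i $ Some j)"

definition blk_x :: "real^('n::finite option)^('n option) \<Rightarrow> real^'n" where
  "blk_x R = (\<chi> j. R $ None $ Some j)"

definition F :: "nat \<Rightarrow> real^('n::finite option)^('n option) \<Rightarrow> real" where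
  "F k R = R $ None $ None * sigma k (blk_r R) - blk_x R \<bullet> (newton_T (k - 1) (blk_r R) *v blk_x R)"

definition S_set :: "nat \<Rightarrow> (real^('n::finite option)^('n option)) set" where
  "S_set k = {R. transpose R = R \<and> blk_r R \<in> Gamma_plus k \<and> F k R > 0}"

end

theory Submission
  imports Defs "HOL-Computational_Algebra.Fundamental_Theorem_Algebra"
begin

text \<open>Since \<open>\<sigma>\<^sub>k\<close> is affine along rank-one lines with slope given by \<open>T\<^sub>k\<^sub>-\<^sub>1\<close>,
  one has \<open>F\<^sub>k(R) = r\<^sub>0\<^sub>0 \<sigma>\<^sub>k(r - x\<^sup>T x / r\<^sub>0\<^sub>0)\<close>, and \<open>S\<close> consists of the symmetric \<open>R\<close> with
  \<open>r\<^sub>0\<^sub>0 > 0\<close> whose Schur complement \<open>r - x\<^sup>T x / r\<^sub>0\<^sub>0\<close> lies in \<open>\<Gamma>\<^sub>k\<^sup>+\<close>. The Schur complement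
  of a sum exceeds the sum of the Schur complements by a positive semidefinite rank-one matrix, so everything
  reduces to Garding's theorem: \<open>\<Gamma>\<^sub>k\<^sup>+\<close> is a convex cone, \<open>\<sigma>\<^sub>k\<close> is increasing on it in positive semidefinite
  directions, and for \<open>A, B\<close> in it the polynomial \<open>\<sigma>\<^sub>k(A + s B)\<close> has only negative real roots \<open>- c\<^sub>i\<close>.
  Then \<open>F\<^sub>k(R) = F\<^sub>k(R') \<Prod> c\<^sub>i\<close> and \<open>F\<^sub>k(R + R') \<ge> F\<^sub>k(R') \<Prod> (1 + c\<^sub>i)\<close>, where
  \<open>c\<^sub>0 = r\<^sub>0\<^sub>0 / r'\<^sub>0\<^sub>0\<close>, and Mahler's inequality gives superadditivity of \<open>F\<^sub>k\<close> to the power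
  \<open>1 / (k + 1)\<close>.\<close>

section \<open>Sums of principal minors\<close>

lemma of_real_of_bool_eq [simp]: "of_real (of_bool P) = of_bool P"
  by simp

text \<open>Principal minors appear as full-size determinants whose rows outside \<open>I\<close>
  are rows of the identity, which avoids types for submatrices. The entries range over any
  commutative ring because real, complex and polynomial entries all occur.\<close>

definition esym :: "nat \<Rightarrow> ('n::finite \<Rightarrow> 'n \<Rightarrow> 'a::comm_ring_1) \<Rightarrow> 'a" where
  "esym k m = (\<Sum>I | card I = k. det (\<chi> i j. if i \<in> I then m i j else of_bool (i = j)))"

lemma esym_0 [simp]: "esym 0 (m :: 'n::finite \<Rightarrow> 'n \<Rightarrow> 'a::comm_ring_1) = 1"
proof -
  have "{I::'n set. card I = 0} = {{}}" by (auto simp: card_0_eq[OF finite])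
  moreover have "(\<chi> i j. of_bool (i = j)) = (mat 1 :: 'a^'n^'n)"
    by (simp add: mat_def vec_eq_iff)
  ultimately show ?thesis by (simp add: esym_def)
qed

lemma esym_scale:
  "esym k (\<lambda>i j. c * m i j) = c ^ k * esym k (m :: 'n::finite \<Rightarrow> 'n \<Rightarrow> 'a::comm_ring_1)"
  unfolding esym_def sum_distrib_left
proof (rule sum.cong[OF refl])
  fix I :: "'n set" assume "I \<in> {I. card I = k}"
  then have k: "card I = k" by simp
  have "(\<chi> i j. if i \<in> I then c * m i j else of_bool (i = j)) =
    (\<chi> i. (if i \<in> I then c else 1) *s (\<chi> j. if i \<in> I then m i j else of_bool (i = j)))"
    by (simp add: vec_eq_iff)
  moreover have "(\<Prod>i\<in>UNIV. if i \<in> I then c else 1) = c ^ k"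
    using prod.mono_neutral_cong_right[of UNIV I "\<lambda>i. if i \<in> I then c else 1" "\<lambda>_. c"] k by simp
  ultimately show "det (\<chi> i j. if i \<in> I then c * m i j else of_bool (i = j)) =
    c ^ k * det (\<chi> i j. if i \<in> I then m i j else of_bool (i = j))"
    by (simp add: det_rows_mul)
qed

lemma esym_diagonal: "esym k (\<lambda>i j::'n::finite. d i * of_bool (i = j) :: 'a::comm_ring_1) = (\<Sum>I | card I = k. \<Prod>i\<in>I. d i)"
  unfolding esym_def
proof (rule sum.cong[OF refl])
  fix I :: "'n set"
  have "(\<Prod>i\<in>UNIV. if i \<in> I then d i else 1) = prod d I"
    by (intro prod.mono_neutral_cong_right) auto
  then show "det (\<chi> i j. if i \<in> I then d i * of_bool (i = j) else of_bool (i = j)) = prod d I"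
    by (subst det_diagonal) (auto cong: if_cong)
qed

lemma esym_id: "esym k (\<lambda>i j::'n::finite. of_bool (i = j) :: 'a::comm_ring_1) = of_nat (CARD('n) choose k)"
  using esym_diagonal[of k "\<lambda>_::'n. 1::'a"] n_subsets[of "UNIV :: 'n set" k] by simp

text \<open>In each Leibniz term the product of sums expands over the set \<open>I\<close> of rows
  in which \<open>m\<close> is chosen; the other rows contribute \<open>t\<close> times identity
  rows. Grouping by \<open>card I\<close> gives the powers of \<open>t\<close>.\<close>

lemma det_shift_expansion:
  "det (\<chi> i j. m i j + t * of_bool (i = j)) =
    (\<Sum>k\<le>CARD('n). t ^ (CARD('n) - k) * esym k (m :: 'n::finite \<Rightarrow> 'n \<Rightarrow> 'a::comm_ring_1))"
proof -
  let ?s = "\<lambda>p. of_int (sign p) :: 'a"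
  let ?D = "\<lambda>I. det (\<chi> i j. if i \<in> I then m i j else of_bool (i = j))"
  have D: "t ^ (CARD('n) - card I) * ?D I =
      (\<Sum>p | p permutes UNIV. ?s p * ((\<Prod>i\<in>I. m i (p i)) * (\<Prod>i\<in>UNIV - I. t * of_bool (i = p i))))"
    for I :: "'n set"
  proof -
    have "(\<Prod>i\<in>UNIV. if i \<in> I then m i (p i) else of_bool (i = p i)) =
        (\<Prod>i\<in>I. m i (p i)) * (\<Prod>i\<in>UNIV - I. of_bool (i = p i))" for p
      by (subst prod.subset_diff[of I UNIV]) (auto simp: mult.commute intro!: arg_cong2[where f="(*)"] prod.cong)
    moreover have "(\<Prod>i\<in>UNIV - I. t * of_bool (i = p i)) =
        t ^ (CARD('n) - card I) * (\<Prod>i\<in>UNIV - I. of_bool (i = p i))" for p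
      by (simp add: prod.distrib card_Diff_subset)
    ultimately show ?thesis
      by (simp add: det_def sum_distrib_left mult_ac cong: if_cong)
  qed
  have "det (\<chi> i j. m i j + t * of_bool (i = j)) =
      (\<Sum>p | p permutes UNIV. \<Sum>I\<in>UNIV. ?s p * ((\<Prod>i\<in>I. m i (p i)) * (\<Prod>i\<in>UNIV - I. t * of_bool (i = p i))))"
    by (simp add: det_def prod_add sum_distrib_left)
  also have "\<dots> = (\<Sum>I\<in>UNIV. t ^ (CARD('n) - card I) * ?D I)"
    unfolding D by (rule sum.swap)
  also have "\<dots> = (\<Sum>k\<le>CARD('n). \<Sum>I | I \<in> UNIV \<and> card I = k. t ^ (CARD('n) - card I) * ?D I)"
    by (rule sum.group[symmetric]) (auto intro: card_mono)
  also have "\<dots> = (\<Sum>k\<le>CARD('n). t ^ (CARD('n) - k) * esym k m)"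
    by (simp add: esym_def sum_distrib_left)
  finally show ?thesis .
qed

lemma det_of_real:
  "det (\<chi> i j. of_real (m i j)) = (of_real (det (\<chi> i j. m i j)) :: 'a::{real_algebra_1,comm_ring_1})"
  by (simp add: det_def)

lemma esym_of_real:
  "esym k (\<lambda>i j. of_real (m i j)) = (of_real (esym k m) :: 'a::{real_algebra_1,comm_ring_1})"
proof -
  have "det (\<chi> i j. if i \<in> I then of_real (m i j) else of_bool (i = j)) =
      (of_real (det (\<chi> i j. if i \<in> I then m i j else of_bool (i = j))) :: 'a)" for I
    by (subst det_of_real[symmetric]) (simp add: if_distrib[of of_real] of_bool_def cong: if_cong)
  then show ?thesis by (simp add: esym_def)
qed

lemma continuous_on_esym:
  fixes m :: "'b::topological_space \<Rightarrow> 'n::finite \<Rightarrow> 'n \<Rightarrow> 'a::{comm_ring_1,real_normed_algebra_1}"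
  assumes "\<And>i j. continuous_on X (\<lambda>x. m x i j)"
  shows "continuous_on X (\<lambda>x. esym k (m x))"
proof -
  have "continuous_on X (\<lambda>x. if i \<in> I then m x i j else of_bool (i = j))" for I i j
    using assms by (cases "i \<in> I") auto
  then show ?thesis
    unfolding esym_def det_def by (auto intro!: continuous_intros continuous_on_prod)
qed

text \<open>Both sides are coefficients, as polynomials in an auxiliary variable \<open>u\<close>,
  of the determinant of \<open>m + (u + t) I\<close>, expanded once around \<open>m + t I\<close>
  and once around \<open>m\<close>.\<close>

lemma esym_shift:
  fixes m :: "'n::finite \<Rightarrow> 'n \<Rightarrow> 'a::real_normed_field"
  assumes "k \<le> CARD('n)"
  shows "esym k (\<lambda>i j. m i j + t * of_bool (i = j)) =
    (\<Sum>j\<le>k. of_nat (CARD('n) - j choose (CARD('n) - k)) * t ^ (k - j) * esym j m)"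
proof -
  let ?n = "CARD('n)"
  let ?d = "\<lambda>i. \<Sum>j\<le>?n - i. of_nat (?n - j choose i) * t ^ (?n - j - i) * esym j m"
  have "(\<Sum>i\<le>?n. esym (?n - i) (\<lambda>i j. m i j + t * of_bool (i = j)) * u ^ i) = (\<Sum>i\<le>?n. ?d i * u ^ i)" for u
  proof -
    have "(\<Sum>i\<le>?n. esym (?n - i) (\<lambda>i j. m i j + t * of_bool (i = j)) * u ^ i) =
        (\<Sum>k\<le>?n. u ^ (?n - k) * esym k (\<lambda>i j. m i j + t * of_bool (i = j)))"
      by (rule sum.reindex_bij_witness[of _ "\<lambda>i. ?n - i" "\<lambda>i. ?n - i"]) auto
    also have "\<dots> = det (\<chi> i j. m i j + t * of_bool (i = j) + u * of_bool (i = j))"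
      by (rule det_shift_expansion[symmetric])
    also have "\<dots> = det (\<chi> i j. m i j + (u + t) * of_bool (i = j))"
      by (simp add: algebra_simps)
    also have "\<dots> = (\<Sum>j\<le>?n. (u + t) ^ (?n - j) * esym j m)"
      by (rule det_shift_expansion)
    also have "\<dots> = (\<Sum>j\<le>?n. \<Sum>i\<le>?n - j. of_nat (?n - j choose i) * u ^ i * t ^ (?n - j - i) * esym j m)"
      by (simp add: binomial_ring sum_distrib_right)
    also have "\<dots> = (\<Sum>(j, i)\<in>Sigma {..?n} (\<lambda>j. {..?n - j}).
        of_nat (?n - j choose i) * u ^ i * t ^ (?n - j - i) * esym j m)"
      by (rule sum.Sigma) auto
    also have "\<dots> = (\<Sum>(i, j)\<in>Sigma {..?n} (\<lambda>i. {..?n - i}).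
        of_nat (?n - j choose i) * u ^ i * t ^ (?n - j - i) * esym j m)"
      by (rule sum.reindex_bij_witness[of _ prod.swap prod.swap]) auto
    also have "\<dots> = (\<Sum>i\<le>?n. \<Sum>j\<le>?n - i. of_nat (?n - j choose i) * u ^ i * t ^ (?n - j - i) * esym j m)"
      by (rule sum.Sigma[symmetric]) auto
    also have "\<dots> = (\<Sum>i\<le>?n. ?d i * u ^ i)"
      by (simp add: sum_distrib_right sum_distrib_left mult_ac)
    finally show ?thesis .
  qed
  then have "\<forall>i\<le>?n. esym (?n - i) (\<lambda>i j. m i j + t * of_bool (i = j)) = ?d i"
    by (intro iffD1[OF polyfun_eq_coeffs] allI)
  then have "esym (?n - (?n - k)) (\<lambda>i j. m i j + t * of_bool (i = j)) = ?d (?n - k)"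
    by simp
  moreover have "?n - j - (?n - k) = k - j" for j using assms by auto
  ultimately show ?thesis using assms by simp
qed

lemma poly_det: "poly (det (\<chi> i j. M i j)) x = det (\<chi> i j. poly (M i j) x)"
  by (simp add: det_def poly_sum poly_prod of_int_poly)

lemma poly_esym: "poly (esym k M) x = esym k (\<lambda>i j. poly (M i j) x)"
  by (simp add: esym_def poly_sum poly_det if_distrib[of "\<lambda>p. poly p x"] of_bool_def cong: if_cong)

section \<open>Matrix pencils as polynomials, and determinants of rank-one perturbations of the
  identity\<close>

lemma coeff_prod_linear:
  fixes a b :: "'i \<Rightarrow> 'a::comm_ring_1"
  assumes "finite I"
  shows "degree (\<Prod>i\<in>I. [:a i, b i:]) \<le> card I \<and> coeff (\<Prod>i\<in>I. [:a i, b i:]) (card I) = (\<Prod>i\<in>I. b i)"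
  using assms
proof (induction I rule: finite_induct)
  case (insert x I)
  let ?P = "\<Prod>i\<in>I. [:a i, b i:]"
  have "degree ([:a x, b x:] * ?P) \<le> Suc (card I)"
    using degree_mult_le[of "[:a x, b x:]" ?P] insert.IH degree_pCons_le[of "a x" "[:b x:]"]
    by simp
  moreover have "coeff ?P (Suc (card I)) = 0"
    using insert.IH by (simp add: coeff_eq_0)
  ultimately show ?case
    using insert by (simp add: coeff_pCons)
qed simp

definition esym_pencil :: "nat \<Rightarrow> ('n::finite \<Rightarrow> 'n \<Rightarrow> 'a::comm_ring_1) \<Rightarrow> ('n \<Rightarrow> 'n \<Rightarrow> 'a) \<Rightarrow> 'a poly" where
  "esym_pencil k a b = esym k (\<lambda>i j. [:a i j, b i j:])"

lemma poly_esym_pencil: "poly (esym_pencil k a b) s = esym k (\<lambda>i j. a i j + s * b i j)"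
  by (simp add: esym_pencil_def poly_esym)

text \<open>Every Leibniz term of a minor on \<open>I\<close> is a constant times
  \<open>card I\<close> linear factors, and its top coefficient takes \<open>b\<close> from each of
  them. Only a degree bound results, since \<open>esym k b\<close> may vanish.\<close>

lemma esym_pencil_degree_coeff:
  fixes a b :: "'n::finite \<Rightarrow> 'n \<Rightarrow> 'a::comm_ring_1"
  shows "degree (esym_pencil k a b) \<le> k \<and> coeff (esym_pencil k a b) k = esym k b"
proof -
  define T where "T I p = (\<Prod>i\<in>UNIV. if i \<in> I then [:a i (p i), b i (p i):] else of_bool (i = p i))"
    for I :: "'n set" and p
  have const: "(\<Prod>i\<in>J. of_bool (i = p i)) = [:\<Prod>i\<in>J. of_bool (i = p i) :: 'a:]" for J :: "'n set" and p
    by (induction J rule: infinite_finite_induct) auto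
  have T: "T I p = smult (\<Prod>i\<in>UNIV - I. of_bool (i = p i)) (\<Prod>i\<in>I. [:a i (p i), b i (p i):])" for I p
  proof -
    have "T I p = (\<Prod>i\<in>UNIV - I. of_bool (i = p i)) * (\<Prod>i\<in>I. [:a i (p i), b i (p i):])"
      unfolding T_def by (subst prod.subset_diff[of I UNIV]) (auto intro!: arg_cong2[where f="(*)"] prod.cong)
    also have "(\<Prod>i\<in>UNIV - I. of_bool (i = p i)) = [:\<Prod>i\<in>UNIV - I. of_bool (i = p i) :: 'a:]"
      by (rule const)
    finally show ?thesis by simp
  qed
  have C: "(\<Prod>i\<in>UNIV - I. of_bool (i = p i)) * (\<Prod>i\<in>I. b i (p i)) =
      (\<Prod>i\<in>UNIV. if i \<in> I then b i (p i) else of_bool (i = p i))" for I :: "'n set" and p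
    by (subst prod.subset_diff[of I UNIV "\<lambda>i. if i \<in> I then b i (p i) else of_bool (i = p i)"])
      (auto intro!: arg_cong2[where f="(*)"] prod.cong)
  have E: "esym_pencil k a b = (\<Sum>I | card I = k. \<Sum>p | p permutes UNIV. of_int (sign p) * T I p)"
    by (simp add: esym_pencil_def esym_def det_def T_def)
  have oi: "of_int z * q = smult (of_int z) q" for z and q :: "'a poly"
    by (simp add: of_int_poly)
  have "degree (of_int (sign p) * T I p) \<le> k" if "card I = k" for I p
    using coeff_prod_linear[of I "\<lambda>i. a i (p i)" "\<lambda>i. b i (p i)"] that
    by (auto simp: T oi intro!: order.trans[OF degree_smult_le])
  then have "degree (esym_pencil k a b) \<le> k"
    unfolding E by (intro degree_sum_le) auto
  moreover have "coeff (of_int (sign p) * T I p) k =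
      of_int (sign p) * (\<Prod>i\<in>UNIV. if i \<in> I then b i (p i) else of_bool (i = p i))" if "card I = k" for I p
    using coeff_prod_linear[of I "\<lambda>i. a i (p i)" "\<lambda>i. b i (p i)"] that
    by (simp add: T oi C[symmetric] mult_ac)
  then have "coeff (esym_pencil k a b) k = esym k b"
    unfolding E by (simp add: coeff_sum esym_def det_def)
  ultimately show ?thesis by simp
qed

text \<open>The matrix determinant lemma. The rows are perturbed one at a time; by linearity in row
  \<open>l\<close>, the new contribution is \<open>w l\<close> times a determinant with row
  \<open>l\<close> equal to \<open>x\<close>.\<close>

lemma det_id_plus_outer:
  fixes w x :: "'n::finite \<Rightarrow> 'a::field"
  shows "det (\<chi> i j. of_bool (i = j) + w i * x j) = 1 + (\<Sum>i\<in>UNIV. w i * x i)"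
proof -
  let ?X = "\<chi> j. x j" and ?e = "\<lambda>i. \<chi> j. of_bool (i = j)"
  have row: "det (\<chi> i. if i = j then ?X else ?e i) = x j" for j
  proof -
    have "(\<Sum>i\<in>UNIV. ?X$i *s row i (mat 1 :: 'a^'n^'n)) = ?X"
      by (simp add: vec_eq_iff row_def mat_def if_distrib cong: if_cong)
    moreover have "row i (mat 1 :: 'a^'n^'n) = ?e i" for i
      by (simp add: vec_eq_iff row_def mat_def)
    ultimately show ?thesis
      using cramer_lemma_transpose[of j ?X "mat 1 :: 'a^'n^'n"]
      by (simp only: det_I mult_1_right vec_lambda_beta)
  qed
  \<comment> \<open>With \<open>x\<close> itself as row \<open>j\<close>, the multiples of
    \<open>x\<close> in the other rows can be removed by row operations.\<close>
  have red: "det (\<chi> i. if i = j then ?X else if i \<in> S then ?e i + w i *s ?X else ?e i) = x j"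
    if "finite S" "j \<notin> S" for j S
    using that
  proof (induction S rule: finite_induct)
    case empty
    show ?case by (simp add: row cong: if_cong)
  next
    case (insert l S)
    let ?A = "\<chi> i. if i = j then ?X else if i \<in> S then ?e i + w i *s ?X else ?e i"
    have "(\<chi> k. if k = l then row l ?A + w l *s row j ?A else row k ?A) =
        (\<chi> i. if i = j then ?X else if i \<in> insert l S then ?e i + w i *s ?X else ?e i)"
      using insert by (auto simp: vec_eq_iff row_def)
    then show ?case
      using insert det_row_operation[of l j ?A "w l"] by auto
  qed
  have "det (\<chi> i. if i \<in> S then ?e i + w i *s ?X else ?e i) = 1 + (\<Sum>i\<in>S. w i * x i)" if "finite S" for S
    using that
  proof (induction S rule: finite_induct)
    case empty
    have "(\<chi> i. ?e i) = (mat 1 :: 'a^'n^'n)" by (simp add: vec_eq_iff mat_def)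
    then show ?case by simp
  next
    case (insert l S)
    let ?c = "\<lambda>i. if i \<in> S then ?e i + w i *s ?X else ?e i"
    have "(\<chi> i. if i \<in> insert l S then ?e i + w i *s ?X else ?e i) =
        (\<chi> i. if i = l then ?e i + w l *s ?X else ?c i)"
      by (auto simp: vec_eq_iff)
    then have "det (\<chi> i. if i \<in> insert l S then ?e i + w i *s ?X else ?e i) =
        det (\<chi> i. if i = l then ?e i else ?c i) + w l * det (\<chi> i. if i = l then ?X else ?c i)"
      using det_row_add[of l ?e "\<lambda>_. w l *s ?X" ?c] det_row_mul[of l "w l" "\<lambda>_. ?X" ?c] by simp
    moreover have "(\<chi> i. if i = l then ?e i else ?c i) = (\<chi> i. ?c i)"
      using insert by (auto simp: vec_eq_iff)
    ultimately show ?case using insert red[of S l] by simp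
  qed
  from this[of UNIV] show ?thesis
    by (simp add: plus_vec_def vector_scalar_mult_def)
qed

section \<open>Hyperbolicity\<close>

text \<open>The logarithmic derivative is the sum of the terms \<open>1 / (z - a)\<close>, each with
  negative imaginary part when \<open>a\<close> is not above the real axis and \<open>z\<close>
  is.\<close>

lemma Im_pderiv_prod_mset:
  assumes "\<And>a. a \<in># A \<Longrightarrow> Im a \<le> 0" and "Im z > 0"
  shows "poly (\<Prod>a\<in>#A. [:-a, 1:]) z \<noteq> 0 \<and>
    Im (poly (pderiv (\<Prod>a\<in>#A. [:-a, 1:])) z / poly (\<Prod>a\<in>#A. [:-a, 1:]) z) \<le> 0 \<and>
    (A \<noteq> {#} \<longrightarrow> Im (poly (pderiv (\<Prod>a\<in>#A. [:-a, 1:])) z / poly (\<Prod>a\<in>#A. [:-a, 1:]) z) < 0)"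
  using assms(1)
proof (induction A)
  case (add a A)
  let ?Q = "\<Prod>a\<in>#A. [:-a, 1:]"
  have a: "Im (z - a) > 0" using add.prems[of a] assms(2) by simp
  then have nz: "z - a \<noteq> 0" by force
  have IH: "poly ?Q z \<noteq> 0" "Im (poly (pderiv ?Q) z / poly ?Q z) \<le> 0"
    using add by simp_all
  have "poly (pderiv ([:-a, 1:] * ?Q)) z = poly ?Q z + (z - a) * poly (pderiv ?Q) z"
    by (simp add: pderiv_mult pderiv_pCons del: mult_pCons_left)
  then have "poly (pderiv ([:-a, 1:] * ?Q)) z / poly ([:-a, 1:] * ?Q) z =
      1 / (z - a) + poly (pderiv ?Q) z / poly ?Q z"
    using nz IH(1) by (simp add: divide_simps del: mult_pCons_left)
  moreover have "Im (1 / (z - a)) < 0"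
    using a nz by (simp add: Im_divide divide_neg_pos complex_eq_iff sum_power2_gt_zero_iff)
  ultimately show ?case using IH nz by simp
qed simp

text \<open>The Gauss-Lucas theorem for a half-plane: the logarithmic derivative of \<open>q\<close>
  has nonzero imaginary part at \<open>z\<close>.\<close>

lemma pderiv_no_root_upper_half_plane:
  fixes q :: "complex poly"
  assumes "degree q \<ge> 1" and nz: "\<And>z. Im z > 0 \<Longrightarrow> poly q z \<noteq> 0" and z: "Im z > 0"
  shows "poly (pderiv q) z \<noteq> 0"
proof -
  have "q \<noteq> 0" using assms(1) by auto
  then obtain A where A: "size A = degree q" "q = smult (lead_coeff q) (\<Prod>a\<in>#A. [:-a, 1:])"
    using alg_closed_imp_factorization by blast
  define Q where "Q = (\<Prod>a\<in>#A. [:-a, 1:])"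
  have "Im a \<le> 0" if "a \<in># A" for a
  proof -
    have "poly Q a = 0" using that by (auto simp: Q_def poly_prod_mset)
    then have "poly q a = 0" using A(2) by (metis Q_def poly_smult mult_zero_right)
    then show ?thesis using nz[of a] by force
  qed
  then have "Im (poly (pderiv Q) z / poly Q z) < 0"
    using Im_pderiv_prod_mset[of A z] z A(1) assms(1) by (auto simp: Q_def)
  then have "poly (pderiv Q) z \<noteq> 0" by auto
  moreover have "pderiv q = smult (lead_coeff q) (pderiv Q)"
    using A(2) by (metis Q_def pderiv_smult)
  ultimately show ?thesis using \<open>q \<noteq> 0\<close> by simp
qed

text \<open>For a kernel vector \<open>z\<close>, pairing the matrix equation with the conjugate of
  \<open>z\<close> gives \<open>H + t N = 0\<close> with \<open>H\<close> real by symmetry and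
  \<open>N\<close> the squared norm. Imaginary parts force \<open>N = 0\<close>.\<close>

lemma det_symmetric_shift_nonzero:
  fixes a :: "'n::finite \<Rightarrow> 'n \<Rightarrow> real"
  assumes sym: "\<And>i j. a i j = a j i" and t: "Im t \<noteq> 0"
  shows "det (\<chi> i j. complex_of_real (a i j) + t * of_bool (i = j)) \<noteq> 0"
proof -
  let ?M = "\<chi> i j. complex_of_real (a i j) + t * of_bool (i = j)"
  have "z = 0" if Mz: "?M *v z = 0" for z :: "complex^'n"
  proof -
    define H where "H = (\<Sum>i\<in>UNIV. \<Sum>j\<in>UNIV. cnj (z$i) * complex_of_real (a i j) * z$j)"
    define N where "N = (\<Sum>i\<in>UNIV. (cmod (z$i))\<^sup>2)"
    have "cnj H = (\<Sum>i\<in>UNIV. \<Sum>j\<in>UNIV. z$i * complex_of_real (a i j) * cnj (z$j))"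
      by (simp add: H_def)
    also have "\<dots> = (\<Sum>j\<in>UNIV. \<Sum>i\<in>UNIV. z$i * complex_of_real (a i j) * cnj (z$j))"
      by (rule sum.swap)
    also have "\<dots> = H"
      unfolding H_def using sym by (intro sum.cong refl) (simp add: mult_ac)
    finally have H: "Im H = 0"
      by (metis Reals_cnj_iff complex_is_Real_iff)
    have N: "complex_of_real N = (\<Sum>i\<in>UNIV. z$i * cnj (z$i))"
      by (simp only: N_def of_real_sum complex_norm_square)
    have Mi: "(?M *v z)$i = (\<Sum>j\<in>UNIV. complex_of_real (a i j) * z$j) + t * z$i" for i
    proof -
      have "(\<Sum>j\<in>UNIV. t * of_bool (i = j) * z$j) = (\<Sum>j\<in>UNIV. if i = j then t * z$j else 0)"
        by (intro sum.cong) auto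
      then show ?thesis by (simp add: matrix_vector_mult_def distrib_right sum.distrib)
    qed
    have "0 = (\<Sum>i\<in>UNIV. cnj (z$i) * (?M *v z)$i)" using Mz by simp
    also have "\<dots> = (\<Sum>i\<in>UNIV. (\<Sum>j\<in>UNIV. cnj (z$i) * complex_of_real (a i j) * z$j) + t * (cnj (z$i) * z$i))"
      unfolding Mi by (simp add: distrib_left sum_distrib_left mult_ac)
    also have "\<dots> = H + t * complex_of_real N"
      by (simp add: H_def N sum.distrib sum_distrib_left mult_ac)
    finally have "Im (H + t * complex_of_real N) = 0" by simp
    then have "N = 0" using H t by simp
    then show "z = 0" by (simp add: N_def sum_nonneg_eq_0_iff vec_eq_iff)
  qed
  then have "\<exists>B. B ** ?M = mat 1" by (simp add: matrix_left_invertible_ker)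
  then show ?thesis using invertible_det_nz invertible_left_inverse by blast
qed

text \<open>The polynomial in \<open>t\<close> on the right of \<open>esym_shift\<close>. Writing it
  by coefficients lets every \<open>esym j m\<close> with \<open>j \<le> k\<close> be read off from
  it.\<close>

definition shift_poly :: "nat \<Rightarrow> ('n::finite \<Rightarrow> 'n \<Rightarrow> 'a::real_normed_field) \<Rightarrow> 'a poly" where
  "shift_poly k m = (\<Sum>j\<le>k. monom (of_nat (CARD('n) - j choose (CARD('n) - k)) * esym j m) (k - j))"

lemma poly_shift_poly:
  fixes m :: "'n::finite \<Rightarrow> 'n \<Rightarrow> 'a::real_normed_field"
  assumes "k \<le> CARD('n)"
  shows "poly (shift_poly k m) t = esym k (\<lambda>i j. m i j + t * of_bool (i = j))"
  unfolding esym_shift[OF assms] shift_poly_def by (simp add: poly_sum poly_monom mult_ac)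

lemma coeff_shift_poly:
  fixes m :: "'n::finite \<Rightarrow> 'n \<Rightarrow> 'a::real_normed_field"
  assumes "j \<le> k"
  shows "coeff (shift_poly k m) (k - j) = of_nat (CARD('n) - j choose (CARD('n) - k)) * esym j m"
proof -
  have "coeff (shift_poly k m) (k - j) =
      (\<Sum>i\<le>k. if i = j then of_nat (CARD('n) - j choose (CARD('n) - k)) * esym j m else 0)"
    unfolding shift_poly_def coeff_sum using assms by (intro sum.cong) auto
  then show ?thesis using assms by simp
qed

lemma degree_shift_poly:
  fixes m :: "'n::finite \<Rightarrow> 'n \<Rightarrow> 'a::real_normed_field"
  assumes "k \<le> CARD('n)"
  shows "degree (shift_poly k m) = k"
proof (rule antisym)
  show "degree (shift_poly k m) \<le> k"
    unfolding shift_poly_def by (intro degree_sum_le) (auto intro: order.trans[OF degree_monom_le])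
  have "coeff (shift_poly k m) k \<noteq> 0"
    using coeff_shift_poly[of 0 k m] assms by simp
  then show "k \<le> degree (shift_poly k m)" by (rule le_degree)
qed

text \<open>Absorption identities for binomial coefficients. Differentiation in the shift lowers the
  degree of \<open>esym\<close> by one, which links all degrees to the determinant.\<close>

lemma pderiv_shift_poly:
  fixes m :: "'n::finite \<Rightarrow> 'n \<Rightarrow> 'a::real_normed_field"
  assumes "k < CARD('n)"
  shows "pderiv (shift_poly (Suc k) m) = smult (of_nat (CARD('n) - k)) (shift_poly k m)"
proof -
  let ?n = "CARD('n)"
  have bin: "(Suc k - j) * (?n - j choose (?n - Suc k)) = (?n - k) * (?n - j choose (?n - k))" if "j \<le> k" for j
  proof -
    obtain r where r: "?n - k = Suc r" using assms by (metis Suc_diff_Suc)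
    then have "?n - Suc k = r" "Suc k - j = ?n - j - r" using that by auto
    then show ?thesis
      using r binomial_absorb_comp[of "?n - j" r] binomial_absorption[of r "?n - j"]
      by (simp del: binomial_Suc_Suc)
  qed
  have smult: "smult c (sum f J) = (\<Sum>j\<in>J. smult c (f j))" for c :: 'a and f and J :: "nat set"
    by (induction J rule: infinite_finite_induct) (auto simp: smult_add_right)
  have "pderiv (shift_poly (Suc k) m) =
      (\<Sum>j\<le>Suc k. monom (of_nat (Suc k - j) * (of_nat (?n - j choose (?n - Suc k)) * esym j m)) (k - j))"
    by (simp add: shift_poly_def higher_pderiv_sum[of 1, simplified] pderiv_monom del: of_nat_Suc sum.atMost_Suc)
  also have "\<dots> = (\<Sum>j\<le>k. monom (of_nat ((Suc k - j) * (?n - j choose (?n - Suc k))) * esym j m) (k - j))"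
    by (simp add: mult.assoc)
  also have "\<dots> = (\<Sum>j\<le>k. monom (of_nat ((?n - k) * (?n - j choose (?n - k))) * esym j m) (k - j))"
    by (intro sum.cong refl) (simp only: atMost_iff bin)
  also have "\<dots> = smult (of_nat (?n - k)) (shift_poly k m)"
    by (simp add: shift_poly_def smult smult_monom mult.assoc)
  finally show ?thesis .
qed

lemma esym_card: "esym CARD('n) m = det (\<chi> i j. m i j)" for m :: "'n::finite \<Rightarrow> 'n \<Rightarrow> 'a::comm_ring_1"
proof -
  have "{I::'n set. card I = CARD('n)} = {UNIV}"
    by (auto dest: card_subset_eq[OF finite subset_UNIV])
  then show ?thesis by (simp add: esym_def)
qed

text \<open>Downward induction on the degree: the determinant has no zero above the real axis, and
  each differentiation in the shift preserves this by Gauss-Lucas.\<close>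

lemma esym_hyperbolic_upper:
  fixes a :: "'n::finite \<Rightarrow> 'n \<Rightarrow> real"
  assumes sym: "\<And>i j. a i j = a j i" and "k \<le> CARD('n)" and "Im t > 0"
  shows "esym k (\<lambda>i j. complex_of_real (a i j) + t * of_bool (i = j)) \<noteq> 0"
proof -
  let ?q = "\<lambda>k. shift_poly k (\<lambda>i j. complex_of_real (a i j))"
  have "\<forall>t. Im t > 0 \<longrightarrow> poly (?q k) t \<noteq> 0"
    using assms(2)
  proof (induction rule: inc_induct)
    case base
    then show ?case
      using det_symmetric_shift_nonzero[of a, OF sym] by (auto simp: poly_shift_poly esym_card)
  next
    case (step k)
    have "degree (?q (Suc k)) \<ge> 1" using step.hyps by (subst degree_shift_poly) auto
    from pderiv_no_root_upper_half_plane[OF this] step show ?case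
      by (auto simp: pderiv_shift_poly)
  qed
  then show ?thesis using assms by (simp add: poly_shift_poly)
qed

lemma esym_uminus: "esym k (\<lambda>i j. - m i j) = (-1) ^ k * esym k m"
  using esym_scale[of k "-1" m] by simp

lemma esym_hyperbolic:
  fixes a :: "'n::finite \<Rightarrow> 'n \<Rightarrow> real"
  assumes sym: "\<And>i j. a i j = a j i" and k: "k \<le> CARD('n)"
    and 0: "esym k (\<lambda>i j. complex_of_real (a i j) + t * of_bool (i = j)) = 0"
  shows "Im t = 0"
proof -
  \<comment> \<open>Negating \<open>a\<close> and \<open>t\<close> together reduces the lower
    half-plane to the upper one.\<close>
  have "esym k (\<lambda>i j. complex_of_real (- a i j) + (- t) * of_bool (i = j)) = 0"
    using esym_uminus[of k "\<lambda>i j. complex_of_real (a i j) + t * of_bool (i = j)"] 0 by simp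
  then have "\<not> Im (- t) > 0"
    using esym_hyperbolic_upper[of "\<lambda>i j. - a i j" k "- t"] sym k by metis
  moreover have "\<not> Im t > 0"
    using esym_hyperbolic_upper[of a k t] sym k 0 by metis
  ultimately show ?thesis by simp
qed

text \<open>\<open>P\<close> is the complex extension of \<open>p\<close>; it splits over the
  complex numbers, and as its roots are real the splitting descends to \<open>p\<close>. Taking
  \<open>P\<close> as a parameter allows the complex instance of the same matrix polynomial to be
  used.\<close>

lemma real_rooted_factorization:
  fixes p :: "real poly" and P :: "complex poly"
  assumes "p \<noteq> 0" and ext: "\<And>x. poly P (of_real x) = of_real (poly p x)"
    and real: "\<And>z. poly P z = 0 \<Longrightarrow> Im z = 0"
  shows "\<exists>A. size A = degree p \<and> p = smult (lead_coeff p) (\<Prod>a\<in>#A. [:-a, 1:])"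
proof -
  obtain x0 where x0: "poly p x0 \<noteq> 0" using assms(1) poly_all_0_iff_0 by blast
  then have "P \<noteq> 0" using ext[of x0] by auto
  then obtain B where B: "P = smult (lead_coeff P) (\<Prod>b\<in>#B. [:-b, 1:])"
    using alg_closed_imp_factorization by blast
  define A where "A = image_mset Re B"
  let ?Q = "\<Prod>a\<in>#A. [:-a, 1:]"
  have "Im b = 0" if "b \<in># B" for b
    using that by (intro real, subst B) (auto simp: poly_prod_mset)
  then have BA: "B = image_mset complex_of_real A"
    by (simp add: A_def multiset.map_comp complex_eq_iff multiset.map_ident_strong)
  have "poly (\<Prod>b\<in>#B. [:-b, 1:]) (of_real x) = of_real (poly ?Q x)" for x
    unfolding BA by (induction A) auto
  then have PQ: "of_real (poly p x) = lead_coeff P * of_real (poly ?Q x)" for x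
    using ext[of x] B by (metis poly_smult)
  \<comment> \<open>The leading coefficient of \<open>P\<close> is real, being a quotient of two
    real values at the non-root \<open>x0\<close>.\<close>
  define c where "c = poly p x0 / poly ?Q x0"
  have "poly ?Q x0 \<noteq> 0" using PQ[of x0] x0 by auto
  then have "lead_coeff P = of_real c" using PQ[of x0] by (simp add: c_def)
  then have "poly p x = poly (smult c ?Q) x" for x
    using PQ[of x] by (metis of_real_eq_iff of_real_mult poly_smult)
  then have p: "p = smult c ?Q" by (simp add: poly_eq_poly_eq_iff[symmetric] fun_eq_iff)
  then have "c \<noteq> 0" using assms(1) by auto
  have "lead_coeff ?Q = 1 \<and> degree ?Q = size A"
  proof (induction A)
    case (add a A)
    then have "(\<Prod>a\<in>#A. [:-a, 1:]) \<noteq> 0" by auto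
    then have "degree ([:-a, 1:] * (\<Prod>a\<in>#A. [:-a, 1:])) = Suc (size A)"
      using add by (subst degree_mult_eq) auto
    moreover have "lead_coeff ([:-a, 1:] * (\<Prod>a\<in>#A. [:-a, 1:])) = 1"
      using add.IH[THEN conjunct1] by (simp only: lead_coeff_mult) simp
    ultimately show ?case by simp
  qed simp
  then show ?thesis using p \<open>c \<noteq> 0\<close> by (intro exI[of _ A]) (metis degree_smult_eq lead_coeff_smult mult.right_neutral)
qed

lemma shift_poly_splits:
  fixes a :: "'n::finite \<Rightarrow> 'n \<Rightarrow> real"
  assumes sym: "\<And>i j. a i j = a j i" and k: "k \<le> CARD('n)"
  shows "\<exists>A. size A = k \<and> shift_poly k a = smult (real (CARD('n) choose k)) (\<Prod>a\<in>#A. [:-a, 1:])"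
proof -
  have lc: "lead_coeff (shift_poly k a) = real (CARD('n) choose k)"
    using coeff_shift_poly[of 0 k a] k by (simp add: degree_shift_poly binomial_symmetric[of k])
  have "poly (shift_poly k (\<lambda>i j. complex_of_real (a i j))) (of_real x) = of_real (poly (shift_poly k a) x)" for x
    using esym_of_real[of k "\<lambda>i j. a i j + x * of_bool (i = j)", where 'a = complex] k
    by (simp add: poly_shift_poly of_bool_def if_distrib[of of_real] cong: if_cong)
  moreover have "shift_poly k a \<noteq> 0" using lc k by (metis leading_coeff_0_iff of_nat_eq_0_iff binomial_eq_0_iff not_le)
  ultimately show ?thesis
    using real_rooted_factorization[of "shift_poly k a" "shift_poly k (\<lambda>i j. complex_of_real (a i j))"]
      esym_hyperbolic[of a k, OF sym k] lc k
    by (simp add: poly_shift_poly degree_shift_poly)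
qed

section \<open>Eigenvalues of symmetric matrices\<close>

lemma mset_as_image:
  assumes "size A = CARD('n::finite)"
  shows "\<exists>f :: 'n \<Rightarrow> 'a. image_mset f (mset_set UNIV) = A"
proof -
  obtain xs where xs: "A = mset xs" by (metis ex_mset)
  obtain g where g: "bij_betw g (UNIV :: 'n set) {0..<CARD('n)}"
    using ex_bij_betw_finite_nat[of "UNIV :: 'n set"] by auto
  have "image_mset (\<lambda>i. xs ! g i) (mset_set UNIV) = image_mset ((!) xs) (mset_set {0..<CARD('n)})"
    using g by (metis (mono_tags) bij_betw_def comp_def image_mset_mset_set multiset.map_comp image_mset_cong)
  also have "\<dots> = mset xs"
    using assms xs by (metis mset_map mset_upt map_nth size_mset)
  finally show ?thesis using xs by auto
qed

lemma charpoly_eq_shift_poly: "charpoly r = shift_poly CARD('n) (\<lambda>i j. - r $ i $ j)" for r :: "real^'n^'n"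
proof -
  have "(poly (if i = j then [:0, 1:] else 0) t - r $ i $ j) = - r $ i $ j + t * of_bool (i = j)" for t i j
    by simp
  then have "poly (charpoly r) t = poly (shift_poly CARD('n) (\<lambda>i j. - r $ i $ j)) t" for t
    by (simp add: charpoly_def poly_det poly_shift_poly esym_card)
  then show ?thesis by (simp add: poly_eq_poly_eq_iff[symmetric] fun_eq_iff)
qed

text \<open>The characteristic polynomial of \<open>r\<close> equals that of the diagonal matrix of
  its eigenvalues, and the functions \<open>esym j\<close> are determined by its
  coefficients.\<close>

lemma sigma_eq_esym:
  fixes r :: "real^'n^'n"
  assumes "transpose r = r"
  shows "sigma j r = esym j (\<lambda>i j. r $ i $ j)"
proof (cases "j \<le> CARD('n)")
  case True
  have sym: "- r $ i $ j = - r $ j $ i" for i j using assms by (metis transpose_def vec_lambda_beta)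
  obtain A where A: "size A = CARD('n)" "charpoly r = (\<Prod>a\<in>#A. [:-a, 1:])"
    using shift_poly_splits[of "\<lambda>i j. - r $ i $ j", OF sym order_refl] by (auto simp: charpoly_eq_shift_poly)
  obtain f :: "'n \<Rightarrow> real" where f: "image_mset f (mset_set UNIV) = A"
    using mset_as_image[OF A(1)] by blast
  have "charpoly r = (\<Prod>i\<in>UNIV. [:- f i, 1:])"
    unfolding A(2) f[symmetric] by (simp add: prod_unfold_prod_mset multiset.map_comp comp_def)
  \<comment> \<open>Real splitting supplies the witness that makes the choice in
    \<open>eigvals\<close> meaningful.\<close>
  then have eig: "charpoly r = (\<Prod>i\<in>UNIV. [:- eigvals r i, 1:])"
    unfolding eigvals_def by (rule someI[of "\<lambda>lam. charpoly r = (\<Prod>i\<in>UNIV. [:- lam i, 1:])"])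
  have "poly (charpoly r) t =
      poly (shift_poly CARD('n) (\<lambda>i j::'n. - (eigvals r i * of_bool (i = j)))) t" for t
    unfolding eig
    by (simp add: poly_prod poly_shift_poly esym_card det_diagonal)
  then have "shift_poly CARD('n) (\<lambda>i j. - r $ i $ j) =
      shift_poly CARD('n) (\<lambda>i j::'n. - (eigvals r i * of_bool (i = j)))"
    by (simp add: charpoly_eq_shift_poly poly_eq_poly_eq_iff[symmetric] fun_eq_iff)
  then have "esym j (\<lambda>i j. - r $ i $ j) = esym j (\<lambda>i j::'n. - (eigvals r i * of_bool (i = j)))"
    using coeff_shift_poly[OF True, of "\<lambda>i j. - r $ i $ j"]
      coeff_shift_poly[OF True, of "\<lambda>i j::'n. - (eigvals r i * of_bool (i = j))"] by simp
  then have "esym j (\<lambda>i j. r $ i $ j) = esym j (\<lambda>i j::'n. eigvals r i * of_bool (i = j))"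
    by (simp add: esym_uminus)
  then show ?thesis by (simp add: esym_diagonal sigma_def)
next
  case False
  then have "{I::'n set. card I = j} = {}"
    using card_mono[of "UNIV :: 'n set"] by auto
  then show ?thesis by (simp add: sigma_def esym_def)
qed

section \<open>Garding's theorem\<close>

text \<open>The symmetric members of \<open>Gamma_plus\<close>, described by minors instead of
  eigenvalues so that continuity in the entries is immediate.\<close>

definition garding_cone :: "nat \<Rightarrow> ('n::finite \<Rightarrow> 'n \<Rightarrow> real) set" where
  "garding_cone k = {a. (\<forall>i j. a i j = a j i) \<and> (\<forall>j. 1 \<le> j \<and> j \<le> k \<longrightarrow> esym j a > 0)}"

lemma garding_cone_sym: "a \<in> garding_cone k \<Longrightarrow> a i j = a j i"
  unfolding garding_cone_def by blast

lemma garding_cone_esym_pos: "a \<in> garding_cone k \<Longrightarrow> j \<le> k \<Longrightarrow> esym j a > 0"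
  by (cases "j = 0") (auto simp: garding_cone_def)

lemma garding_cone_mono: "a \<in> garding_cone k \<Longrightarrow> j \<le> k \<Longrightarrow> a \<in> garding_cone j"
  by (auto simp: garding_cone_def)

text \<open>All terms of the expansion \<open>esym_shift\<close> are nonnegative, and the term
  \<open>j = k\<close> is \<open>esym k a\<close>.\<close>

lemma esym_shift_ge:
  fixes a :: "'n::finite \<Rightarrow> 'n \<Rightarrow> real"
  assumes "\<And>j. j \<le> k \<Longrightarrow> esym j a \<ge> 0" and "k \<le> CARD('n)" and "t \<ge> 0"
  shows "esym k (\<lambda>i j. a i j + t * of_bool (i = j)) \<ge> esym k a"
proof -
  let ?f = "\<lambda>j. real (CARD('n) - j choose (CARD('n) - k)) * t ^ (k - j) * esym j a"
  have "?f k \<le> (\<Sum>j\<le>k. ?f j)"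
    using assms by (intro member_le_sum) auto
  then show ?thesis using esym_shift[OF assms(2), of a t] by simp
qed

text \<open>Hyperbolicity makes the root real, and a nonnegative real shift cannot decrease the
  positive value \<open>esym k a\<close> to zero.\<close>

lemma garding_cone_shift_root:
  fixes a :: "'n::finite \<Rightarrow> 'n \<Rightarrow> real"
  assumes a: "a \<in> garding_cone k" and k: "k \<le> CARD('n)"
    and 0: "esym k (\<lambda>i j. complex_of_real (a i j) + z * of_bool (i = j)) = 0"
  shows "Im z = 0 \<and> Re z < 0"
proof -
  have Im: "Im z = 0" using esym_hyperbolic[OF garding_cone_sym[OF a] k 0] .
  then have z: "z = of_real (Re z)" by (simp add: complex_eq_iff)
  have "(\<lambda>i j. complex_of_real (a i j) + z * of_bool (i = j)) =
      (\<lambda>i j. complex_of_real (a i j + Re z * of_bool (i = j)))"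
    using z by (auto simp: fun_eq_iff)
  then have "complex_of_real (esym k (\<lambda>i j. a i j + Re z * of_bool (i = j))) = 0"
    using 0 esym_of_real[of k "\<lambda>i j. a i j + Re z * of_bool (i = j)", where 'a = complex] by metis
  then have "esym k (\<lambda>i j. a i j + Re z * of_bool (i = j)) = 0" by simp
  then have "\<not> Re z \<ge> 0"
    using esym_shift_ge[of k a "Re z"] garding_cone_esym_pos[OF a] k by (metis less_imp_le order_refl not_le)
  with Im show ?thesis by simp
qed

section \<open>Stability of \<open>esym k\<close> along complex multiples of matrices in the
  cone\<close>

lemma poly_norm_ge_lower_half_plane_roots:
  fixes p :: "complex poly"
  assumes roots: "\<And>z. poly p z = 0 \<Longrightarrow> Im z < 0" and u: "Im u > 0"
  shows "norm (poly p u) \<ge> norm (lead_coeff p) * Im u ^ degree p"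
proof -
  have "p \<noteq> 0" using roots[of u] u by auto
  then obtain A where A: "size A = degree p" "p = smult (lead_coeff p) (\<Prod>a\<in>#A. [:-a, 1:])"
    using alg_closed_imp_factorization by blast
  have "Im a < 0" if "a \<in># A" for a
    using that by (intro roots, subst A(2)) (auto simp: poly_prod_mset)
  then have "Im u ^ size A \<le> norm (poly (\<Prod>a\<in>#A. [:-a, 1:]) u)"
  proof (induction A)
    case (add a A)
    \<comment> \<open>A root below the real axis is at distance at least \<open>Im u\<close> from
      \<open>u\<close>, so each factor contributes at least \<open>Im u\<close>.\<close>
    have "Im u \<le> Im (u - a)" using add.prems[of a] by simp
    also have "\<dots> \<le> norm (u - a)" using abs_Im_le_cmod[of "u - a"] by linarith
    finally have "Im u * Im u ^ size A \<le> norm (u - a) * norm (poly (\<Prod>a\<in>#A. [:-a, 1:]) u)"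
      using add u by (intro mult_mono) auto
    moreover have "poly (\<Prod>a\<in>#add_mset a A. [:-a, 1:]) u = (u - a) * poly (\<Prod>a\<in>#A. [:-a, 1:]) u"
      by (simp add: algebra_simps)
    ultimately show ?case by (simp only: norm_mult size_add_mset power_Suc)
  qed simp
  then have "norm (lead_coeff p) * Im u ^ degree p \<le> norm (lead_coeff p) * norm (poly (\<Prod>a\<in>#A. [:-a, 1:]) u)"
    using A(1) by (intro mult_left_mono) auto
  also have "\<dots> = norm (poly p u)" using A(2) by (metis norm_mult poly_smult)
  finally show ?thesis .
qed

text \<open>Suppose there is a root \<open>u\<close> in the closed upper half-plane, and move \<open>t0\<close> upwards to \<open>t0 + i \<tau>\<close>.
  In the homogeneous coordinates \<open>(\<eta>, w, \<theta>)\<close> with \<open>u = w / \<eta>\<close> and \<open>\<tau> = \<theta> / \<eta>\<close> the set of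
  such roots is compact, so there is a last \<open>\<tau>\<close> with a root. That root is not real, and hence cannot disappear:
  for larger \<open>\<tau>\<close> the polynomial in \<open>u\<close> has all its roots in the lower half-plane, which bounds it away
  from zero.\<close>

lemma esym_stability_step:
  fixes Y :: "'n::finite \<Rightarrow> 'n \<Rightarrow> complex"
  assumes a: "a \<in> garding_cone k" and k: "k \<le> CARD('n)"
    and real: "\<And>u t. Im t > 0 \<Longrightarrow>
      esym k (\<lambda>i j. Y i j + of_real u * of_real (a i j) + t * of_bool (i = j)) \<noteq> 0"
    and u0: "Im u0 \<ge> 0" and t0: "Im t0 > 0"
  shows "esym k (\<lambda>i j. Y i j + u0 * of_real (a i j) + t0 * of_bool (i = j)) \<noteq> 0"
proof
  assume bad: "esym k (\<lambda>i j. Y i j + u0 * of_real (a i j) + t0 * of_bool (i = j)) = 0"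
  define G :: "real \<times> complex \<times> real \<Rightarrow> complex" where
    "G = (\<lambda>(\<eta>, w, \<theta>). esym k (\<lambda>i j. of_real \<eta> * (Y i j + t0 * of_bool (i = j)) +
      w * of_real (a i j) + \<i> * of_real \<theta> * of_bool (i = j)))"
  define Z where "Z = {(\<eta>, w, \<theta>). 0 \<le> \<eta> \<and> 0 \<le> \<theta> \<and> 0 \<le> Im w \<and> \<eta> + norm w + \<theta> = 1 \<and> G (\<eta>, w, \<theta>) = 0}"
  have G_scale: "G (c * \<eta>, of_real c * w, c * \<theta>) = of_real c ^ k * G (\<eta>, w, \<theta>)" for c \<eta> w \<theta>
    unfolding G_def by (simp add: esym_scale[symmetric] algebra_simps)
  have contG: "continuous_on UNIV G"
    unfolding G_def case_prod_unfold by (intro continuous_on_esym continuous_intros)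
  have a_pos: "esym k a > 0" using garding_cone_esym_pos[OF a] by simp
  \<comment> \<open>There are no roots at infinity: for \<open>\<eta> = 0\<close> and
    \<open>w \<noteq> 0\<close> the quotient \<open>\<i> \<theta> / w\<close> would be a negative
    real \<open>x\<close>, so that \<open>\<theta> = x * Im w\<close> vanishes and then
    \<open>x\<close> does too; for \<open>w = 0\<close> only a nonzero multiple of the identity
    remains.\<close>
  have \<eta>_pos: "\<eta> > 0" if "(\<eta>, w, \<theta>) \<in> Z" for \<eta> w \<theta>
  proof (rule ccontr)
    assume "\<not> \<eta> > 0"
    then have Z: "\<eta> = 0" "0 \<le> \<theta>" "0 \<le> Im w" "norm w + \<theta> = 1"
      "esym k (\<lambda>i j. w * of_real (a i j) + \<i> * of_real \<theta> * of_bool (i = j)) = 0"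
      using that by (auto simp: Z_def G_def)
    show False
    proof (cases "w = 0")
      case True
      then have "esym k (\<lambda>i j::'n. \<i> * of_bool (i = j)) = 0" using Z by simp
      then show False using k by (simp add: esym_scale esym_id)
    next
      case False
      have "w ^ k * esym k (\<lambda>i j. of_real (a i j) + \<i> * of_real \<theta> / w * of_bool (i = j)) = 0"
        using Z(5) False by (simp add: esym_scale[symmetric] distrib_left)
      then have "esym k (\<lambda>i j. of_real (a i j) + \<i> * of_real \<theta> / w * of_bool (i = j)) = 0"
        using False by simp
      from garding_cone_shift_root[OF a k this]
      obtain x where x: "\<i> * of_real \<theta> / w = complex_of_real x" "x < 0"
        by (metis complex_eq_iff complex_of_real_def complex.sel)
      then have "\<i> * of_real \<theta> = complex_of_real x * w" using False by (simp add: field_simps)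
      then have "\<theta> = x * Im w" by (simp add: complex_eq_iff)
      then have "\<theta> = 0" using Z x(2) by (metis mult_nonpos_nonneg less_imp_le antisym)
      then show False using x by simp
    qed
  qed
  have "closed Z"
  proof -
    have "Z = {z. 0 \<le> fst z} \<inter> {z. 0 \<le> snd (snd z)} \<inter> {z. 0 \<le> Im (fst (snd z))} \<inter>
        {z. fst z + norm (fst (snd z)) + snd (snd z) = 1} \<inter> {z. G z = 0}"
      by (auto simp: Z_def)
    moreover have "closed \<dots>"
      using contG by (intro closed_Int closed_Collect_le closed_Collect_eq continuous_intros)
    ultimately show ?thesis by simp
  qed
  moreover have "bounded Z"
  proof (rule boundedI)
    fix z assume "z \<in> Z"
    then obtain \<eta> w \<theta> where z: "z = (\<eta>, w, \<theta>)" "0 \<le> \<eta>" "0 \<le> \<theta>" "\<eta> + norm w + \<theta> = 1"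
      by (auto simp: Z_def)
    have "norm z \<le> norm \<eta> + norm (w, \<theta>)" unfolding z(1) by (rule norm_Pair_le)
    also have "\<dots> \<le> norm \<eta> + (norm w + norm \<theta>)" using norm_Pair_le[of w \<theta>] by simp
    finally show "norm z \<le> 1" using z by simp
  qed
  ultimately have "compact Z" by (simp add: compact_eq_bounded_closed)
  have in_Z: "\<exists>c>0. (c, of_real c * u, c * \<tau>) \<in> Z" if "\<tau> \<ge> 0" "Im u \<ge> 0" "G (1, u, \<tau>) = 0" for u \<tau>
  proof -
    define c where "c = 1 / (1 + norm u + \<tau>)"
    have "1 + norm u + \<tau> > 0" using that(1) norm_ge_zero[of u] by linarith
    then have c: "c > 0" "c * (1 + norm u + \<tau>) = 1"
      by (auto simp: c_def)
    have "G (c, of_real c * u, c * \<tau>) = 0" using G_scale[of c 1 u \<tau>] that by simp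
    moreover have "c + norm (of_real c * u) + c * \<tau> = 1" using c by (simp add: norm_mult algebra_simps)
    ultimately have "(c, of_real c * u, c * \<tau>) \<in> Z" using c that by (simp add: Z_def)
    with c show ?thesis by blast
  qed
  have "G (1, u0, 0) = 0" using bad by (simp add: G_def algebra_simps)
  then have "Z \<noteq> {}" using in_Z[of 0 u0] u0 by auto
  moreover have "continuous_on Z (\<lambda>z. snd (snd z) / fst z)"
    using \<eta>_pos by (intro continuous_intros) force
  ultimately have "\<exists>z\<in>Z. \<forall>y\<in>Z. snd (snd y) / fst y \<le> snd (snd z) / fst z"
    by (rule continuous_attains_sup[OF \<open>compact Z\<close>])
  then obtain z where z: "z \<in> Z" "\<And>y. y \<in> Z \<Longrightarrow> snd (snd y) / fst y \<le> snd (snd z) / fst z"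
    by blast
  obtain \<eta> w \<theta> where z_eq: "z = (\<eta>, w, \<theta>)" by (cases z)
  have \<eta>: "\<eta> > 0" using \<eta>_pos z(1) z_eq by blast
  define u where "u = w / of_real \<eta>"
  define \<tau> where "\<tau> = \<theta> / \<eta>"
  have \<tau>: "\<tau> \<ge> 0" and Im_u: "Im u \<ge> 0" and "G (\<eta>, w, \<theta>) = 0"
    using z(1) \<eta> by (auto simp: z_eq Z_def \<tau>_def u_def)
  then have G0: "G (1, u, \<tau>) = 0"
    using G_scale[of \<eta> 1 u \<tau>] \<eta> by (simp add: u_def \<tau>_def)
  have Gt: "G (1, v, s) = esym k (\<lambda>i j. (Y i j + (t0 + \<i> * of_real s) * of_bool (i = j)) + v * of_real (a i j))" for v s
    by (simp add: G_def algebra_simps)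
  have Im_u: "Im u > 0"
  proof (rule ccontr)
    assume "\<not> Im u > 0"
    then have "u = of_real (Re u)" using Im_u by (simp add: complex_eq_iff)
    then have "esym k (\<lambda>i j. Y i j + of_real (Re u) * of_real (a i j) + (t0 + \<i> * of_real \<tau>) * of_bool (i = j)) = 0"
      using G0 unfolding Gt by (simp add: algebra_simps)
    then show False using real[of "t0 + \<i> * of_real \<tau>" "Re u"] t0 \<tau> by simp
  qed
  \<comment> \<open>The bound does not depend on \<open>s\<close>, so it persists as
    \<open>s\<close> decreases to \<open>\<tau>\<close>, where \<open>G\<close> vanishes.\<close>
  have low: "norm (G (1, u, s)) \<ge> esym k a * Im u ^ k" if "s > \<tau>" for s
  proof -
    define p where "p = esym_pencil k (\<lambda>i j. Y i j + (t0 + \<i> * of_real s) * of_bool (i = j)) (\<lambda>i j. complex_of_real (a i j))"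
    have p: "poly p v = G (1, v, s)" for v by (simp add: p_def poly_esym_pencil Gt)
    have "coeff p k = of_real (esym k a)" "degree p \<le> k"
      using esym_pencil_degree_coeff[of k _ "\<lambda>i j. complex_of_real (a i j)"] by (auto simp: p_def esym_of_real)
    moreover from this have "degree p = k" using a_pos by (metis le_degree antisym of_real_eq_0_iff less_irrefl)
    moreover have "Im v < 0" if root: "poly p v = 0" for v
    proof (rule ccontr)
      assume "\<not> Im v < 0"
      then obtain c where "c > 0" "(c, of_real c * v, c * s) \<in> Z"
        using in_Z[of s v] root \<open>s > \<tau>\<close> \<tau> by (auto simp: p)
      then show False using z(2)[of "(c, of_real c * v, c * s)"] \<open>s > \<tau>\<close> by (simp add: z_eq \<tau>_def)
    qed
    ultimately show ?thesis
      using poly_norm_ge_lower_half_plane_roots[of p u] Im_u a_pos by (simp add: p)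
  qed
  have "continuous_on UNIV (\<lambda>s. norm (G (1, u, s)))"
    by (intro continuous_on_norm continuous_on_compose2[OF contG] continuous_intros) auto
  then have "((\<lambda>s. norm (G (1, u, s))) \<longlongrightarrow> norm (G (1, u, \<tau>))) (at_right \<tau>)"
    by (auto simp: continuous_on_def intro: tendsto_within_subset)
  moreover have "eventually (\<lambda>s. esym k a * Im u ^ k \<le> norm (G (1, u, s))) (at_right \<tau>)"
    using low by (auto simp: eventually_at_filter)
  ultimately have "esym k a * Im u ^ k \<le> norm (G (1, u, \<tau>))"
    by (rule tendsto_lowerbound) simp
  then have "esym k a * Im u ^ k \<le> 0" using G0 by simp
  moreover have "esym k a * Im u ^ k > 0" using Im_u a_pos by simp
  ultimately show False by linarith
qed

lemma esym_stable1:
  fixes x a :: "'n::finite \<Rightarrow> 'n \<Rightarrow> real"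
  assumes x: "\<And>i j. x i j = x j i" and a: "a \<in> garding_cone k" and k: "k \<le> CARD('n)"
    and u: "Im u \<ge> 0" and t: "Im t > 0"
  shows "esym k (\<lambda>i j. of_real (x i j) + u * of_real (a i j) + t * of_bool (i = j)) \<noteq> 0"
proof (rule esym_stability_step[OF a k _ u t])
  fix v :: real and t :: complex assume t: "Im t > 0"
  have "x i j + v * a i j = x j i + v * a j i" for i j
    using x[of i j] garding_cone_sym[OF a, of i j] by simp
  from esym_hyperbolic_upper[of "\<lambda>i j. x i j + v * a i j", OF this k t]
  show "esym k (\<lambda>i j. of_real (x i j) + of_real v * of_real (a i j) + t * of_bool (i = j)) \<noteq> 0"
    by simp
qed

text \<open>A second application of the stability step: \<open>esym_stable1\<close>, applied to the
  symmetric matrix \<open>v a\<close>, now covers the real values of \<open>u\<close>.\<close>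

lemma esym_stable2:
  fixes a b :: "'n::finite \<Rightarrow> 'n \<Rightarrow> real"
  assumes a: "a \<in> garding_cone k" and b: "b \<in> garding_cone k" and k: "k \<le> CARD('n)"
    and s: "Im s \<ge> 0" and u: "Im u \<ge> 0" and t: "Im t > 0"
  shows "esym k (\<lambda>i j. s * of_real (b i j) + u * of_real (a i j) + t * of_bool (i = j)) \<noteq> 0"
proof (rule esym_stability_step[OF a k _ u t])
  fix v :: real and t :: complex assume t: "Im t > 0"
  have "v * a i j = v * a j i" for i j
    using garding_cone_sym[OF a, of i j] by simp
  from esym_stable1[of "\<lambda>i j. v * a i j", OF this b k s t]
  show "esym k (\<lambda>i j. s * of_real (b i j) + of_real v * of_real (a i j) + t * of_bool (i = j)) \<noteq> 0"
    by (simp add: add_ac)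
qed

text \<open>Along the segment from \<open>t I\<close> the value starts positive, so a failure would
  produce a zero. Multiplying that matrix by \<open>\<i>\<close> puts all its coefficients into the
  closed upper half-plane, and the one of the identity into the open one, against
  \<open>esym_stable2\<close>.\<close>

lemma esym_combination_pos:
  fixes a b :: "'n::finite \<Rightarrow> 'n \<Rightarrow> real"
  assumes a: "a \<in> garding_cone k" and b: "b \<in> garding_cone k" and k: "k \<le> CARD('n)"
    and s: "s \<ge> 0" and u: "u \<ge> 0" and t: "t > 0"
  shows "esym k (\<lambda>i j. s * b i j + u * a i j + t * of_bool (i = j)) > 0"
proof (rule ccontr)
  assume neg: "\<not> ?thesis"
  define f where "f l = esym k (\<lambda>i j. (l * s) * b i j + (l * u) * a i j + t * of_bool (i = j))" for l :: real
  have "continuous_on {0..1} f"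
    unfolding f_def by (intro continuous_on_esym continuous_intros)
  moreover have "f 0 = t ^ k * real (CARD('n) choose k)"
    by (simp add: f_def esym_scale esym_id)
  then have "0 \<le> f 0" using t by simp
  moreover have "f 1 \<le> 0" using neg by (simp add: f_def)
  ultimately obtain l where l: "0 \<le> l" "l \<le> 1" "f l = 0"
    using IVT2'[of f 1 0 0] by auto
  have "esym k (\<lambda>i j. (\<i> * of_real (l * s)) * of_real (b i j) + (\<i> * of_real (l * u)) * of_real (a i j) +
      (\<i> * of_real t) * of_bool (i = j)) =
      esym k (\<lambda>i j. \<i> * complex_of_real ((l * s) * b i j + (l * u) * a i j + t * of_bool (i = j)))"
    by (simp add: algebra_simps)
  also have "\<dots> = \<i> ^ k * of_real (f l)"
    by (simp only: esym_scale esym_of_real f_def)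
  also have "\<dots> = 0" using l by simp
  finally show False
    using esym_stable2[OF a b k, of "\<i> * of_real (l * s)" "\<i> * of_real (l * u)" "\<i> * of_real t"] l s u t by simp
qed

section \<open>Sums in the cone and real-rooted pencils\<close>

lemma garding_cone_open:
  fixes a :: "'n::finite \<Rightarrow> 'n \<Rightarrow> real"
  assumes a: "a \<in> garding_cone k"
  shows "\<exists>e>0. (\<lambda>i j. a i j - e * of_bool (i = j)) \<in> garding_cone k"
proof -
  have "eventually (\<lambda>e. esym j (\<lambda>i j. a i j - e * of_bool (i = j)) > 0) (at_right 0)" if "j \<in> {1..k}" for j
  proof -
    have "continuous_on UNIV (\<lambda>e. esym j (\<lambda>i j. a i j - e * of_bool (i = j)))"
      by (intro continuous_on_esym continuous_intros)
    then have "((\<lambda>e. esym j (\<lambda>i j. a i j - e * of_bool (i = j))) \<longlongrightarrow> esym j (\<lambda>i j. a i j - 0 * of_bool (i = j))) (at_right 0)"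
      unfolding continuous_on_def by (blast intro: tendsto_within_subset)
    moreover have "esym j a > 0" using garding_cone_esym_pos[OF a] that by simp
    ultimately show ?thesis by (intro order_tendstoD(1)) auto
  qed
  then have "eventually (\<lambda>e. \<forall>j\<in>{1..k}. esym j (\<lambda>i j. a i j - e * of_bool (i = j)) > 0) (at_right 0)"
    by (intro eventually_ball_finite) auto
  moreover have "eventually (\<lambda>e::real. e > 0) (at_right 0)" by (simp add: eventually_at_filter)
  ultimately have "eventually (\<lambda>e. e > 0 \<and> (\<forall>j\<in>{1..k}. esym j (\<lambda>i j. a i j - e * of_bool (i = j)) > 0)) (at_right 0)"
    by eventually_elim simp
  then obtain e where "e > 0" "\<forall>j\<in>{1..k}. esym j (\<lambda>i j. a i j - e * of_bool (i = j)) > 0"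
    using eventually_happens'[OF trivial_limit_at_right_real] by blast
  then show ?thesis
    using garding_cone_sym[OF a] by (intro exI[of _ e]) (auto simp: garding_cone_def)
qed

text \<open>Openness of the cone gives \<open>a = (a - e I) + e I\<close>, which provides the
  strictly positive identity term that \<open>esym_combination_pos\<close> demands.\<close>

lemma garding_cone_esym_add_pos:
  fixes a b :: "'n::finite \<Rightarrow> 'n \<Rightarrow> real"
  assumes a: "a \<in> garding_cone k" and b: "b \<in> garding_cone k" and k: "k \<le> CARD('n)" and s: "s \<ge> 0"
  shows "esym k (\<lambda>i j. a i j + s * b i j) > 0"
proof -
  obtain e where e: "e > 0" "(\<lambda>i j. a i j - e * of_bool (i = j)) \<in> garding_cone k"
    using garding_cone_open[OF a] by blast
  from esym_combination_pos[OF e(2) b k s, of 1 e] e(1)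
  show ?thesis by (simp add: algebra_simps)
qed

text \<open>Writing \<open>z b = z (b - e I) + (z e) I\<close> turns a root \<open>z\<close> above
  the real axis into a zero excluded by \<open>esym_stable1\<close>; negation handles the other
  half-plane.\<close>

lemma esym_pencil_real_rooted:
  fixes x b :: "'n::finite \<Rightarrow> 'n \<Rightarrow> real"
  assumes x: "\<And>i j. x i j = x j i" and b: "b \<in> garding_cone k" and k: "k \<le> CARD('n)"
    and 0: "esym k (\<lambda>i j. of_real (x i j) + z * of_real (b i j)) = 0"
  shows "Im z = 0"
proof -
  obtain e where e: "e > 0" and be: "(\<lambda>i j. b i j - e * of_bool (i = j)) \<in> garding_cone k"
    using garding_cone_open[OF b] by blast
  have upper: "\<not> Im z > 0" if x: "\<And>i j. x i j = x j i" and 0: "esym k (\<lambda>i j. of_real (x i j) + z * of_real (b i j)) = 0"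
    for z and x :: "'n \<Rightarrow> 'n \<Rightarrow> real"
  proof
    assume z: "Im z > 0"
    then have "Im (z * of_real e) > 0" using e by simp
    from esym_stable1[of x, OF x be k less_imp_le[OF z] this] 0 show False
      by (simp add: algebra_simps)
  qed
  have "esym k (\<lambda>i j. of_real (- x i j) + (- z) * of_real (b i j)) = 0"
    using 0 esym_uminus[of k "\<lambda>i j. of_real (x i j) + z * of_real (b i j)"] by simp
  then have "\<not> Im (- z) > 0" using upper[of "\<lambda>i j. - x i j" "- z"] x by simp
  moreover have "\<not> Im z > 0" using upper[of x z] x 0 by blast
  ultimately show ?thesis by simp
qed

text \<open>\<open>C\<close> collects the negated roots of the pencil. They are positive because the
  pencil takes positive values at every \<open>s \<ge> 0\<close>.\<close>

lemma garding_cone_pencil_factorization: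
  fixes a b :: "'n::finite \<Rightarrow> 'n \<Rightarrow> real"
  assumes a: "a \<in> garding_cone k" and b: "b \<in> garding_cone k" and k: "k \<le> CARD('n)"
  shows "\<exists>C. size C = k \<and> (\<forall>c\<in>#C. c > 0) \<and>
    (\<forall>s. esym k (\<lambda>i j. a i j + s * b i j) = esym k b * (\<Prod>c\<in>#C. s + c))"
proof -
  let ?p = "esym_pencil k a b"
  have b_pos: "esym k b > 0" using garding_cone_esym_pos[OF b] by simp
  have p: "degree ?p \<le> k" "coeff ?p k = esym k b" using esym_pencil_degree_coeff by blast+
  then have deg: "degree ?p = k" using b_pos by (simp add: le_degree antisym)
  have "poly (esym_pencil k (\<lambda>i j. complex_of_real (a i j)) (\<lambda>i j. of_real (b i j))) (of_real x) = of_real (poly ?p x)" for x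
    by (simp add: poly_esym_pencil esym_of_real[symmetric])
  moreover have "?p \<noteq> 0" using p b_pos by auto
  moreover have "Im z = 0"
    if "poly (esym_pencil k (\<lambda>i j. complex_of_real (a i j)) (\<lambda>i j. of_real (b i j))) z = 0" for z
    using esym_pencil_real_rooted[OF garding_cone_sym[OF a] b k] that by (simp add: poly_esym_pencil)
  ultimately obtain A where A: "size A = k" "?p = smult (esym k b) (\<Prod>x\<in>#A. [:-x, 1:])"
    using real_rooted_factorization[of ?p] deg p by metis
  have f: "esym k (\<lambda>i j. a i j + s * b i j) = esym k b * (\<Prod>x\<in>#A. s - x)" for s
    using poly_esym_pencil[of k a b s] by (simp add: A(2) poly_prod_mset multiset.map_comp comp_def)
  have "x < 0" if "x \<in># A" for x
  proof (rule ccontr)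
    assume "\<not> x < 0"
    moreover have "esym k (\<lambda>i j. a i j + x * b i j) = 0" using that by (auto simp: f)
    ultimately show False using garding_cone_esym_add_pos[OF a b k, of x] by simp
  qed
  then show ?thesis
    using A(1) f by (intro exI[of _ "image_mset uminus A"]) (auto simp: multiset.map_comp comp_def)
qed

lemma garding_cone_add:
  fixes a b :: "'n::finite \<Rightarrow> 'n \<Rightarrow> real"
  assumes a: "a \<in> garding_cone k" and b: "b \<in> garding_cone k" and k: "k \<le> CARD('n)"
  shows "(\<lambda>i j. a i j + b i j) \<in> garding_cone k"
  using garding_cone_esym_add_pos[OF garding_cone_mono[OF a] garding_cone_mono[OF b], of _ 1] k
    garding_cone_sym[OF a] garding_cone_sym[OF b]
  by (auto simp: garding_cone_def)

lemma garding_cone_scale: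
  assumes "a \<in> garding_cone k" and "c > 0"
  shows "(\<lambda>i j. c * a i j) \<in> garding_cone k"
  using assms by (auto simp: garding_cone_def esym_scale)

text \<open>The factored pencil is compared at \<open>s = 0\<close> and \<open>s = 1\<close>, where
  each factor grows from \<open>c\<close> to \<open>1 + c\<close>.\<close>

lemma esym_add_ge:
  fixes a b :: "'n::finite \<Rightarrow> 'n \<Rightarrow> real"
  assumes a: "a \<in> garding_cone k" and b: "b \<in> garding_cone k" and k: "k \<le> CARD('n)"
  shows "esym k (\<lambda>i j. a i j + b i j) \<ge> esym k a"
proof -
  obtain C where C: "\<forall>c\<in>#C. c > 0" "\<And>s. esym k (\<lambda>i j. a i j + s * b i j) = esym k b * (\<Prod>c\<in>#C. s + c)"
    using garding_cone_pencil_factorization[OF a b k] by blast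
  from C(1) have "(\<Prod>c\<in>#C. 0 + c) \<le> (\<Prod>c\<in>#C. 1 + c) \<and> 0 \<le> (\<Prod>c\<in>#C. 0 + c)"
    by (induction C) (auto intro!: mult_mono simp: less_imp_le)
  then show ?thesis
    using C(2)[of 0] C(2)[of 1] garding_cone_esym_pos[OF b, of k] by (simp add: mult_left_mono)
qed

lemma coeff_prod_mset_pos:
  fixes C :: "real multiset"
  assumes "\<forall>c\<in>#C. c > 0" and "i \<le> size C"
  shows "coeff (\<Prod>c\<in>#C. [:c, 1:]) i > 0"
proof -
  \<comment> \<open>Nonnegativity of all coefficients is carried along because those beyond
    \<open>size C\<close> are zero.\<close>
  have "(\<forall>i. coeff (\<Prod>c\<in>#C. [:c, 1:]) i \<ge> 0) \<and> (\<forall>i\<le>size C. coeff (\<Prod>c\<in>#C. [:c, 1:]) i > 0)"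
    using assms(1)
  proof (induction C)
    case (add c C)
    let ?Q = "\<Prod>c\<in>#C. [:c, 1:]"
    have "coeff (\<Prod>c\<in>#add_mset c C. [:c, 1:]) i = c * coeff ?Q i + (case i of 0 \<Rightarrow> 0 | Suc m \<Rightarrow> coeff ?Q m)" for i
      by (simp add: coeff_pCons)
    moreover have "c * coeff ?Q (Suc m) + coeff ?Q m > 0" if "m \<le> size C" for m
      using add that by (intro add_nonneg_pos) (auto intro!: mult_nonneg_nonneg)
    ultimately show ?case
      using add by (auto split: nat.split)
  qed (auto simp: coeff_pCons split: nat.split)
  then show ?thesis using assms(2) by blast
qed

text \<open>All roots of the shift polynomial are negative, so all its coefficients are positive.
  Hence a limit of cone members can leave the cone only where \<open>esym k\<close> vanishes, which
  later makes a subset of a segment both open and closed.\<close>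

lemma garding_cone_if_nonneg:
  fixes a :: "'n::finite \<Rightarrow> 'n \<Rightarrow> real"
  assumes sym: "\<And>i j. a i j = a j i" and k: "k \<le> CARD('n)"
    and nonneg: "\<And>j. j \<le> k \<Longrightarrow> esym j a \<ge> 0" and pos: "esym k a > 0"
  shows "a \<in> garding_cone k"
proof -
  obtain A where A: "size A = k" "shift_poly k a = smult (real (CARD('n) choose k)) (\<Prod>x\<in>#A. [:-x, 1:])"
    using shift_poly_splits[of a k, OF sym k] by blast
  have "x < 0" if "x \<in># A" for x
  proof (rule ccontr)
    assume "\<not> x < 0"
    then have "esym k (\<lambda>i j. a i j + x * of_bool (i = j)) > 0"
      using esym_shift_ge[of k a x] nonneg k pos by force
    moreover have "poly (shift_poly k a) x = 0"
      using that by (auto simp: A(2) poly_prod_mset)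
    ultimately show False by (simp add: poly_shift_poly k)
  qed
  then have neg: "\<forall>c\<in>#image_mset uminus A. c > 0" by auto
  have "esym j a > 0" if "j \<le> k" for j
  proof -
    have "coeff (shift_poly k a) (k - j) > 0"
      using coeff_prod_mset_pos[OF neg, of "k - j"] A k
      by (simp add: multiset.map_comp comp_def)
    then show ?thesis
      using coeff_shift_poly[OF that, of a] by (simp add: zero_less_mult_iff)
  qed
  then show ?thesis using sym by (auto simp: garding_cone_def)
qed

section \<open>Rank-one updates\<close>

lemma newton_T_mult_Suc:
  "newton_T (Suc j) r *v x = sigma (Suc j) r *\<^sub>R x - r *v (newton_T j r *v x)"
proof -
  have sum: "(\<Sum>i\<in>I. f i) *v x = (\<Sum>i\<in>I. f i *v x)" for I :: "nat set" and f :: "nat \<Rightarrow> real^'a^'a"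
    by (induction I rule: infinite_finite_induct) (auto simp: matrix_vector_mult_add_rdistrib)
  have T: "newton_T j r *v x = (\<Sum>i\<in>{0..j}. ((-1) ^ i * sigma (j - i) r) *\<^sub>R (mpow r i *v x))" for j
    by (simp add: newton_T_def sum scaleR_matrix_vector_assoc)
  have "r *v (newton_T j r *v x) = (\<Sum>i\<in>{0..j}. ((-1) ^ i * sigma (j - i) r) *\<^sub>R (mpow r (Suc i) *v x))"
    unfolding T by (simp add: linear_sum[OF matrix_vector_mul_linear] linear_cmul[OF matrix_vector_mul_linear]
      matrix_vector_mul_assoc)
  then show ?thesis
    unfolding T[of "Suc j"] sum.atLeast0_atMost_Suc_shift by (simp add: sum_negf del: mpow.simps(2))
qed

text \<open>A nonzero polynomial stays bounded away from zero at infinity; after a sign change it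
  eventually exceeds its leading coefficient.\<close>

lemma real_poly_eq_0_if_vanishing:
  fixes p :: "real poly"
  assumes "\<And>t. t > B \<Longrightarrow> \<bar>poly p t\<bar> \<le> K / (t - B)"
  shows "p = 0"
proof (rule ccontr)
  assume "p \<noteq> 0"
  define q where "q = smult (sgn (lead_coeff p)) p"
  have "lead_coeff q > 0" using \<open>p \<noteq> 0\<close> by (auto simp: q_def sgn_if not_less less_le)
  then obtain N where N: "\<And>t. t \<ge> N \<Longrightarrow> poly q t \<ge> lead_coeff q"
    using poly_pinfty_gt_lc by blast
  \<comment> \<open>Chosen so large that \<open>K / (t - B)\<close> drops below the leading
    coefficient of \<open>q\<close>.\<close>
  define t where "t = max N (B + (\<bar>K\<bar> + 1) / lead_coeff q)"
  have "B + (\<bar>K\<bar> + 1) / lead_coeff q \<le> t" by (simp add: t_def)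
  moreover have "(\<bar>K\<bar> + 1) / lead_coeff q > 0" using \<open>lead_coeff q > 0\<close> by simp
  ultimately have t: "t > B" and "(\<bar>K\<bar> + 1) / lead_coeff q \<le> t - B" by linarith+
  then have "\<bar>K\<bar> + 1 \<le> (t - B) * lead_coeff q"
    using \<open>lead_coeff q > 0\<close> by (simp add: pos_divide_le_eq)
  then have "K < lead_coeff q * (t - B)" by (simp add: mult.commute)
  then have "K / (t - B) < lead_coeff q" using t by (simp add: pos_divide_less_eq)
  also have "\<dots> \<le> poly q t" by (intro N) (simp add: t_def)
  also have "\<dots> \<le> \<bar>poly p t\<bar>" by (auto simp: q_def sgn_if)
  finally show False using assms[OF t] by simp
qed

text \<open>The Newton transformations are the coefficients of the adjugate of \<open>r + t I\<close> up to the
  Cayley--Hamilton remainder \<open>newton_T n r\<close>. Its contribution to the polynomial identity in \<open>t\<close>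
  vanishes as \<open>t\<close> tends to infinity.\<close>

lemma esym_rank_one_update:
  fixes r :: "real^'n^'n" and x :: "real^'n"
  assumes sym: "transpose r = r" and k: "1 \<le> k" "k \<le> CARD('n)"
  shows "esym k (\<lambda>i j. r$i$j + s * (x$i * x$j)) = esym k (\<lambda>i j. r$i$j) + s * (x \<bullet> (newton_T (k - 1) r *v x))"
proof -
  let ?n = "CARD('n)"
  define e where "e j = esym j (\<lambda>i j. r$i$j)" for j
  define e' where "e' j = esym j (\<lambda>i j. r$i$j + s * (x$i * x$j))" for j
  define T where "T j = newton_T j r *v x" for j
  \<comment> \<open>\<open>d k\<close> is the defect of the claimed identity in degree
    \<open>k\<close>; all defects are gathered in \<open>p\<close> and shown to vanish
    together.\<close>
  define d where "d k = e' k - e k - s * (x \<bullet> T (k - 1))" for k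
  define p where "p = (\<Sum>k=1..?n. monom (d k) (?n - k))"
  have T0: "T 0 = x" by (simp add: T_def newton_T_def sigma_eq_esym[OF sym])
  have TSuc: "r *v T j = e (Suc j) *\<^sub>R x - T (Suc j)" for j
    by (simp add: T_def newton_T_mult_Suc e_def sigma_eq_esym[OF sym])
  obtain B where B: "\<And>v. norm (r *v v) \<le> B * norm v"
    using bounded_linear.bounded[OF matrix_vector_mul_bounded_linear[of r]] by (metis mult.commute)
  have "\<bar>poly p t\<bar> \<le> \<bar>s\<bar> * norm x * norm (T ?n) / (t - B)" if t: "t > B" for t
  proof -
    define M where "M = (\<chi> i j. r$i$j + t * of_bool (i = j))"
    have Mv: "M *v v = r *v v + t *\<^sub>R v" for v
    proof -
      have "(\<Sum>j\<in>UNIV. t * of_bool (i = j) * v$j) = (\<Sum>j\<in>UNIV. if i = j then t * v$j else 0)" for i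
        by (intro sum.cong) auto
      then show ?thesis by (simp add: M_def vec_eq_iff matrix_vector_mult_def distrib_right sum.distrib)
    qed
    \<comment> \<open>For \<open>t\<close> above the operator bound \<open>B\<close>, the matrix
      \<open>M = r + t I\<close> is invertible and its inverse has norm at most
      \<open>1 / (t - B)\<close>.\<close>
    have Mnorm: "norm v \<le> norm (M *v v) / (t - B)" for v
    proof -
      have "t * norm v \<le> norm (t *\<^sub>R v)" by (simp add: mult_right_mono)
      also have "\<dots> = norm (M *v v - r *v v)" by (simp add: Mv)
      also have "\<dots> \<le> norm (M *v v) + B * norm v" using norm_triangle_ineq4[of "M *v v" "r *v v"] B[of v] by linarith
      finally show ?thesis using t by (simp add: field_simps)
    qed
    have "v = 0" if "M *v v = 0" for v using Mnorm[of v] that by simp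
    then have "\<exists>M'. M' ** M = mat 1" by (simp add: matrix_left_invertible_ker)
    then obtain M' where M': "M' ** M = mat 1" "M ** M' = mat 1"
      by (metis matrix_left_right_inverse)
    have inv: "M *v (M' *v v) = v" "M' *v (M *v v) = v" for v by (simp_all add: matrix_vector_mul_assoc M')
    define w where "w = M' *v x"
    define v where "v = M' *v T ?n"
    have detM: "det M = (\<Sum>k\<le>?n. t ^ (?n - k) * e k)"
      unfolding M_def e_def by (rule det_shift_expansion)
    \<comment> \<open>The recursion for the Newton transformations makes the sum telescope with
      remainder \<open>T m\<close>; at \<open>m = n\<close> the scalar sum is
      \<open>det M\<close>.\<close>
    have "(\<Sum>j<m. t ^ (m - 1 - j) *\<^sub>R (M *v T j)) = (\<Sum>k\<le>m. t ^ (m - k) * e k) *\<^sub>R x - T m" for m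
    proof (induction m)
      case 0
      then show ?case by (simp add: T0 e_def)
    next
      case (Suc m)
      have "(\<Sum>j<m. t ^ (Suc m - 1 - j) *\<^sub>R (M *v T j)) = t *\<^sub>R (\<Sum>j<m. t ^ (m - 1 - j) *\<^sub>R (M *v T j))"
        unfolding scaleR_sum_right by (intro sum.cong refl) (simp add: power_Suc[symmetric] Suc_diff_Suc del: power_Suc)
      then have "(\<Sum>j<Suc m. t ^ (Suc m - 1 - j) *\<^sub>R (M *v T j)) =
          t *\<^sub>R ((\<Sum>k\<le>m. t ^ (m - k) * e k) *\<^sub>R x - T m) + M *v T m"
        using Suc.IH by simp
      moreover have "(\<Sum>k\<le>Suc m. t ^ (Suc m - k) * e k) = t * (\<Sum>k\<le>m. t ^ (m - k) * e k) + e (Suc m)"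
        unfolding sum_distrib_left by (simp add: Suc_diff_le mult.assoc)
      ultimately show ?case by (simp only: Mv TSuc) (simp add: algebra_simps)
    qed
    from this[of ?n] have "M *v (\<Sum>j<?n. t ^ (?n - 1 - j) *\<^sub>R T j) = det M *\<^sub>R x - T ?n"
      by (simp add: detM linear_sum[OF matrix_vector_mul_linear] linear_cmul[OF matrix_vector_mul_linear])
    then have "(\<Sum>j<?n. t ^ (?n - 1 - j) *\<^sub>R T j) = M' *v (det M *\<^sub>R x - T ?n)"
      by (metis inv(2))
    also have "\<dots> = det M *\<^sub>R w - v"
      by (simp add: w_def v_def linear_diff[OF matrix_vector_mul_linear] linear_cmul[OF matrix_vector_mul_linear])
    finally have adj: "(\<Sum>j<?n. t ^ (?n - 1 - j) * (x \<bullet> T j)) = det M * (x \<bullet> w) - x \<bullet> v"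
      by (metis (no_types, lifting) inner_diff_right inner_scaleR_right inner_sum_right sum.cong)
    \<comment> \<open>Since \<open>M w = x\<close>, the factor \<open>M\<close> splits off and
      leaves a rank-one perturbation of the identity.\<close>
    have "(\<chi> i j. (r$i$j + s * (x$i * x$j)) + t * of_bool (i = j)) = M ** (\<chi> i j. of_bool (i = j) + w$i * (s * x$j))"
    proof -
      have "(M ** (\<chi> i j. of_bool (i = j) + w$i * (s * x$j)))$i$j = M$i$j + (M *v w)$i * (s * x$j)" for i j
      proof -
        have "(\<Sum>l\<in>UNIV. M$i$l * of_bool (l = j)) = (\<Sum>l\<in>UNIV. if l = j then M$i$l else 0)"
          by (intro sum.cong) auto
        then show ?thesis
          by (simp add: matrix_matrix_mult_def matrix_vector_mult_def distrib_left sum.distrib sum_distrib_right mult.assoc)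
      qed
      then show ?thesis by (simp add: vec_eq_iff w_def inv) (simp add: M_def)
    qed
    then have "det (\<chi> i j. (r$i$j + s * (x$i * x$j)) + t * of_bool (i = j)) = det M * (1 + s * (x \<bullet> w))"
      by (simp only: det_mul det_id_plus_outer) (simp add: inner_vec_def sum_distrib_left mult_ac)
    then have e': "(\<Sum>k\<le>?n. t ^ (?n - k) * e' k) = det M * (1 + s * (x \<bullet> w))"
      unfolding e'_def by (simp only: det_shift_expansion)
    have split0: "(\<Sum>k\<le>?n. t ^ (?n - k) * f k) = t ^ ?n * f 0 + (\<Sum>k=1..?n. t ^ (?n - k) * f k)" for f
      by (simp add: atMost_atLeast0 sum.atLeast_Suc_atMost)
    have "(\<Sum>k=1..?n. t ^ (?n - k) * (x \<bullet> T (k - 1))) = (\<Sum>j<?n. t ^ (?n - 1 - j) * (x \<bullet> T j))"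
      by (rule sum.reindex_bij_witness[of _ Suc "\<lambda>k. k - 1"]) auto
    then have T: "(\<Sum>k=1..?n. t ^ (?n - k) * (x \<bullet> T (k - 1))) = det M * (x \<bullet> w) - x \<bullet> v"
      using adj by simp
    have "poly p t = (\<Sum>k=1..?n. t ^ (?n - k) * e' k) - (\<Sum>k=1..?n. t ^ (?n - k) * e k) -
        s * (\<Sum>k=1..?n. t ^ (?n - k) * (x \<bullet> T (k - 1)))"
      by (simp add: p_def poly_sum poly_monom d_def sum_subtractf left_diff_distrib right_diff_distrib sum_distrib_left mult_ac)
    \<comment> \<open>The powers \<open>t ^ n\<close> and all multiples of \<open>det M\<close>
      cancel; only the remainder \<open>v\<close>, of order \<open>1 / (t - B)\<close>, is
      left.\<close>
    also have "\<dots> = s * (x \<bullet> v)"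
      unfolding T using e' detM unfolding split0 by (simp add: e_def e'_def algebra_simps)
    finally have "\<bar>poly p t\<bar> = \<bar>s\<bar> * \<bar>x \<bullet> v\<bar>" by (simp add: abs_mult)
    also have "\<dots> \<le> \<bar>s\<bar> * (norm x * norm v)" by (intro mult_left_mono Cauchy_Schwarz_ineq2) auto
    also have "\<dots> \<le> \<bar>s\<bar> * (norm x * (norm (T ?n) / (t - B)))"
      using Mnorm[of v] by (intro mult_left_mono) (auto simp: v_def inv)
    finally show ?thesis by simp
  qed
  then have "p = 0" by (rule real_poly_eq_0_if_vanishing)
  moreover have "coeff p (?n - k) = d k"
  proof -
    have "coeff p (?n - k) = (\<Sum>i=1..?n. if i = k then d k else 0)"
      unfolding p_def coeff_sum using k by (intro sum.cong) auto
    then show ?thesis using k by simp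
  qed
  ultimately have "d k = 0" by simp
  then show ?thesis by (simp add: d_def e_def e'_def T_def)
qed

text \<open>The rank-one update of the zero matrix shows that every \<open>esym j\<close> of the
  rank-one matrix is nonnegative. In \<open>esym_shift\<close> the term with index zero is then
  strictly positive.\<close>

lemma rank_one_shift_in_garding_cone:
  fixes x :: "real^'n"
  assumes "\<epsilon> > 0" and "k \<le> CARD('n)"
  shows "(\<lambda>i j. x$i * x$j + \<epsilon> * of_bool (i = j)) \<in> garding_cone k"
proof -
  have e0: "esym j (\<lambda>i j::'n. 0 :: real) = 0" if "j \<ge> 1" for j
    using esym_scale[of j "0 :: real" "\<lambda>i j::'n. 0"] that by (simp add: power_0_left)
  have "esym j (\<lambda>i j. x$i * x$j) \<ge> 0" if "j \<le> CARD('n)" for j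
  proof (cases "j = 0")
    case False
    have sym: "transpose (0 :: real^'n^'n) = 0" by (simp add: transpose_def vec_eq_iff)
    have "mpow (0 :: real^'n^'n) i = 0" if "i \<ge> 1" for i
      using that by (cases i) (auto simp: matrix_matrix_mult_def vec_eq_iff)
    then have "newton_T (j - 1) (0 :: real^'n^'n) = (\<Sum>i\<in>{0..j - 1}. if i = 0 then sigma (j - 1) (0 :: real^'n^'n) *\<^sub>R mat 1 else 0)"
      unfolding newton_T_def by (intro sum.cong) auto
    then have "newton_T (j - 1) (0 :: real^'n^'n) = sigma (j - 1) (0 :: real^'n^'n) *\<^sub>R mat 1" by simp
    moreover have "sigma (j - 1) (0 :: real^'n^'n) \<ge> 0"
      using e0[of "j - 1"] by (cases "j - 1 = 0") (auto simp: sigma_eq_esym[OF sym])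
    ultimately show ?thesis
      using esym_rank_one_update[OF sym, of j 1 x] e0[of j] that False
      by (simp add: scaleR_matrix_vector_assoc[symmetric])
  qed simp
  note nonneg = this
  have "esym j (\<lambda>i j. x$i * x$j + \<epsilon> * of_bool (i = j)) > 0" if j: "j \<le> CARD('n)" for j
  proof -
    let ?f = "\<lambda>l. real (CARD('n) - l choose (CARD('n) - j)) * \<epsilon> ^ (j - l) * esym l (\<lambda>i j. x$i * x$j)"
    have "0 < ?f 0" using assms(1) j by simp
    also have "?f 0 \<le> (\<Sum>l\<le>j. ?f l)"
      using assms(1) j nonneg by (intro member_le_sum) auto
    finally show ?thesis using esym_shift[OF j, of "\<lambda>i j. x$i * x$j" \<epsilon>] by simp
  qed
  then show ?thesis using assms(2) by (auto simp: garding_cone_def mult.commute)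
qed

text \<open>A rank-one matrix need not lie in the cone itself, so \<open>\<epsilon> I\<close> is
  added, monotonicity in cone directions is applied, and \<open>\<epsilon>\<close> tends to
  zero.\<close>

lemma garding_cone_add_rank_one:
  fixes x :: "real^'n"
  assumes a: "a \<in> garding_cone k" and k: "k \<le> CARD('n)"
  shows "(\<lambda>i j. a i j + x$i * x$j) \<in> garding_cone k"
    and "esym k (\<lambda>i j. a i j + x$i * x$j) \<ge> esym k a"
proof -
  have ge: "esym j (\<lambda>i j. a i j + x$i * x$j) \<ge> esym j a" if j: "j \<le> k" for j
  proof -
    let ?f = "\<lambda>\<epsilon>. esym j (\<lambda>i j. a i j + (x$i * x$j + \<epsilon> * of_bool (i = j)))"
    have "continuous_on UNIV ?f"
      by (intro continuous_on_esym continuous_intros)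
    then have "(?f \<longlongrightarrow> ?f 0) (at_right 0)"
      unfolding continuous_on_def by (blast intro: tendsto_within_subset)
    moreover have "?f \<epsilon> \<ge> esym j a" if "\<epsilon> > 0" for \<epsilon>
      using esym_add_ge[OF garding_cone_mono[OF a j] rank_one_shift_in_garding_cone[OF that]] j k by simp
    then have "eventually (\<lambda>\<epsilon>. esym j a \<le> ?f \<epsilon>) (at_right 0)"
      by (auto simp: eventually_at_filter)
    ultimately have "esym j a \<le> ?f 0" by (rule tendsto_lowerbound) simp
    then show ?thesis by simp
  qed
  then show "esym k (\<lambda>i j. a i j + x$i * x$j) \<ge> esym k a" by simp
  show "(\<lambda>i j. a i j + x$i * x$j) \<in> garding_cone k"
    using ge garding_cone_esym_pos[OF a] garding_cone_sym[OF a]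
    unfolding garding_cone_def by (auto intro: less_le_trans)
qed

section \<open>Mahler's inequality\<close>

lemma mahler_inequality:
  fixes c :: "'i \<Rightarrow> real"
  assumes S: "finite S" "S \<noteq> {}" and c: "\<And>i. i \<in> S \<Longrightarrow> c i > 0"
  shows "1 + (\<Prod>i\<in>S. c i) powr (1 / card S) \<le> (\<Prod>i\<in>S. 1 + c i) powr (1 / card S)"
proof -
  let ?n = "real (card S)" and ?P = "\<Prod>i\<in>S. 1 + c i"
  have n: "?n > 0" using S by (simp add: card_gt_0_iff)
  have P: "?P > 0" using c by (intro prod_pos) (simp add: add_pos_pos)
  \<comment> \<open>The arithmetic-geometric mean inequality is applied to
    \<open>1 / (1 + c i)\<close> and to \<open>c i / (1 + c i)\<close>, whose arithmetic means add
    up to one.\<close>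
  have "(\<Prod>i\<in>S. 1 / (1 + c i)) powr (1 / ?n) + (\<Prod>i\<in>S. c i / (1 + c i)) powr (1 / ?n) \<le>
      (\<Sum>i\<in>S. 1 / (1 + c i) / ?n) + (\<Sum>i\<in>S. c i / (1 + c i) / ?n)"
    using less_imp_le[OF c] by (intro add_mono arith_geom_mean S) (auto intro!: divide_nonneg_nonneg add_nonneg_nonneg)
  also have "\<dots> = (\<Sum>i\<in>S. 1 / ?n)"
    unfolding sum.distrib[symmetric]
  proof (intro sum.cong refl)
    fix i assume "i \<in> S"
    then have "1 + c i \<noteq> 0" using c[of i] by simp
    then show "1 / (1 + c i) / ?n + c i / (1 + c i) / ?n = 1 / ?n"
      by (simp add: add_divide_distrib[symmetric])
  qed
  also have "\<dots> = 1" using n by simp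
  also have "(\<Prod>i\<in>S. 1 / (1 + c i)) powr (1 / ?n) = 1 / ?P powr (1 / ?n)"
    using P by (simp add: prod_dividef powr_divide)
  also have "(\<Prod>i\<in>S. c i / (1 + c i)) powr (1 / ?n) = (\<Prod>i\<in>S. c i) powr (1 / ?n) / ?P powr (1 / ?n)"
    using P c by (simp add: prod_dividef powr_divide prod_nonneg less_imp_le)
  finally show ?thesis using P by (simp add: add_divide_distrib[symmetric])
qed

lemma mahler_inequality_mset:
  fixes C :: "real multiset"
  assumes "C \<noteq> {#}" and "\<forall>c\<in>#C. c > 0"
  shows "1 + (\<Prod>c\<in>#C. c) powr (1 / size C) \<le> (\<Prod>c\<in>#C. 1 + c) powr (1 / size C)"
proof -
  obtain xs where xs: "C = mset xs" by (metis ex_mset)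
  have conv: "(\<Prod>c\<in>#C. f c) = (\<Prod>i\<in>{..<length xs}. f (xs ! i))" for f :: "real \<Rightarrow> real"
    unfolding xs by (simp add: prod_mset_prod_list prod.list_conv_set_nth atLeast0LessThan flip: mset_map)
  show ?thesis
    using mahler_inequality[of "{..<length xs}" "(!) xs"] assms
    unfolding conv by (auto simp: xs)
qed

section \<open>Schur complements\<close>

definition schur_complement :: "real^('n::finite option)^('n option) \<Rightarrow> 'n \<Rightarrow> 'n \<Rightarrow> real" where
  "schur_complement R i j = R $ Some i $ Some j - R $ None $ Some i * R $ None $ Some j / R $ None $ None"

lemma transpose_blk_r: "transpose R = R \<Longrightarrow> transpose (blk_r R) = blk_r R"
  by (simp add: transpose_def blk_r_def vec_eq_iff)

lemma Gamma_plus_iff_garding_cone: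
  assumes "transpose r = r"
  shows "r \<in> Gamma_plus k \<longleftrightarrow> (\<lambda>i j. r $ i $ j) \<in> garding_cone k"
proof -
  have "r $ i $ j = r $ j $ i" for i j using assms by (metis transpose_def vec_lambda_beta)
  then show ?thesis by (simp add: Gamma_plus_def garding_cone_def sigma_eq_esym[OF assms])
qed

lemma F_eq_esym:
  fixes R :: "real^('n::finite option)^('n option)"
  assumes "transpose R = R"
  shows "F k R = R $ None $ None * esym k (\<lambda>i j. blk_r R $ i $ j) - blk_x R \<bullet> (newton_T (k - 1) (blk_r R) *v blk_x R)"
  by (simp add: F_def sigma_eq_esym[OF transpose_blk_r[OF assms]])

text \<open>The Schur complement is the rank-one update of the block with
  \<open>s = - 1 / r00\<close>, writing \<open>r00\<close> for the corner entry.\<close>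

lemma F_eq_schur_complement:
  fixes R :: "real^('n::finite option)^('n option)"
  assumes "transpose R = R" and "1 \<le> k" "k \<le> CARD('n)" and "R $ None $ None \<noteq> 0"
  shows "F k R = R $ None $ None * esym k (schur_complement R)"
proof -
  have "schur_complement R = (\<lambda>i j. blk_r R $ i $ j + (- 1 / R $ None $ None) * (blk_x R $ i * blk_x R $ j))"
    by (simp add: fun_eq_iff schur_complement_def blk_r_def blk_x_def)
  then show ?thesis
    using esym_rank_one_update[OF transpose_blk_r[OF assms(1)] assms(2,3), of "- 1 / R $ None $ None" "blk_x R"]
      assms(4) by (simp add: F_eq_esym[OF assms(1)] field_simps)
qed

text \<open>Forwards, \<open>r - s x x^T\<close> is followed from \<open>s = 0\<close> to
  \<open>s = 1 / a\<close>, and membership in the cone is preserved by connectedness. Backwards,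
  \<open>r\<close> is the Schur complement plus a rank-one matrix.\<close>

lemma S_set_iff:
  fixes R :: "real^('n::finite option)^('n option)"
  assumes k: "1 \<le> k" "k \<le> CARD('n)"
  shows "R \<in> S_set k \<longleftrightarrow> transpose R = R \<and> R $ None $ None > 0 \<and> schur_complement R \<in> garding_cone k"
proof (cases "transpose R = R")
  case sym: True
  define a where "a = R $ None $ None"
  define x where "x = blk_x R"
  define r where "r = (\<lambda>i j. blk_r R $ i $ j)"
  define q where "q j = x \<bullet> (newton_T (j - 1) (blk_r R) *v x)" for j
  have rsym: "r i j = r j i" for i j
    using transpose_blk_r[OF sym] unfolding r_def by (metis transpose_def vec_lambda_beta)
  have upd: "esym j (\<lambda>i j. r i j + s * (x$i * x$j)) = esym j r + s * q j" if "1 \<le> j" "j \<le> CARD('n)" for s j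
    using esym_rank_one_update[OF transpose_blk_r[OF sym] that, of s x] by (simp add: r_def q_def)
  have F: "F k R = a * esym k r - q k"
    using F_eq_esym[OF sym] by (simp add: a_def r_def q_def x_def)
  have schur: "schur_complement R = (\<lambda>i j. r i j - x$i * x$j / a)"
    by (simp add: fun_eq_iff schur_complement_def a_def r_def x_def blk_r_def blk_x_def)
  have "a > 0 \<and> schur_complement R \<in> garding_cone k" if r: "r \<in> garding_cone k" and "F k R > 0"
  proof -
    have e: "esym k r > 0" using garding_cone_esym_pos[OF r] by simp
    \<comment> \<open>\<open>q k\<close> is the slope of \<open>esym k\<close> in the direction of a
      rank-one matrix, which cannot decrease \<open>esym k\<close> on the cone.\<close>
    have q: "q k \<ge> 0"
      using garding_cone_add_rank_one(2)[OF r k(2), of x] upd[OF k, of 1] by simp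
    then have "a * esym k r > 0" using \<open>F k R > 0\<close> F by simp
    then have a: "a > 0" using e by (simp add: zero_less_mult_iff)
    define f where "f j s = esym j (\<lambda>i j. r i j + (- s) * (x$i * x$j))" for j s
    have cont: "continuous_on UNIV (f j)" for j
      unfolding f_def by (intro continuous_on_esym continuous_intros)
    \<comment> \<open>Weak inequalities make \<open>W\<close> closed; on it they are automatically
      strict, which makes it relatively open.\<close>
    define W where "W = {0..1/a} \<inter> {s. \<forall>j\<in>{..k}. f j s \<ge> 0}"
    \<comment> \<open>\<open>f k\<close> is affine and nonincreasing in \<open>s\<close>, and its
      value at the endpoint \<open>1 / a\<close> is \<open>F k R / a\<close>.\<close>
    have fk: "f k s > 0" if "s \<in> {0..1/a}" for s
    proof -
      have "s * q k \<le> 1 / a * q k" using that q by (intro mult_right_mono) auto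
      moreover have "1 / a * q k < esym k r" using F \<open>F k R > 0\<close> a by (simp add: field_simps)
      ultimately show ?thesis unfolding f_def upd[OF k] by simp
    qed
    have cone: "(\<lambda>i j. r i j + (- s) * (x$i * x$j)) \<in> garding_cone k" if "s \<in> W" for s
    proof (rule garding_cone_if_nonneg[OF _ k(2)])
      show "r i j + (- s) * (x$i * x$j) = r j i + (- s) * (x$j * x$i)" for i j
        by (simp add: rsym[of i j] mult.commute)
    qed (use that fk in \<open>auto simp: W_def f_def\<close>)
    then have "f j s > 0" if "s \<in> W" "j \<le> k" for j s
      using garding_cone_esym_pos that by (fastforce simp: f_def)
    then have "W = {0..1/a} \<inter> {s. \<forall>j\<in>{..k}. f j s > 0}"
      unfolding W_def by (auto intro: less_imp_le)
    moreover have "open {s. \<forall>j\<in>{..k}. f j s > 0}"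
    proof -
      have "{s. \<forall>j\<in>{..k}. f j s > 0} = (\<Inter>j\<in>{..k}. {s. f j s > 0})" by auto
      moreover have "open {s. f j s > 0}" for j by (rule open_Collect_less[OF continuous_on_const cont])
      ultimately show ?thesis by (auto intro!: open_INT)
    qed
    ultimately have "openin (top_of_set {0..1/a}) W" by (metis openin_open_Int)
    moreover have "closed {s. \<forall>j\<in>{..k}. f j s \<ge> 0}"
    proof -
      have "{s. \<forall>j\<in>{..k}. f j s \<ge> 0} = (\<Inter>j\<in>{..k}. {s. f j s \<ge> 0})" by auto
      moreover have "closed {s. f j s \<ge> 0}" for j by (rule closed_Collect_le[OF continuous_on_const cont])
      ultimately show ?thesis by auto
    qed
    then have "closedin (top_of_set {0..1/a}) W" unfolding W_def by (rule closedin_closed_Int)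
    moreover have "connected {0..1/a}" by simp
    ultimately have "W = {} \<or> W = {0..1/a}" by (meson connected_clopen)
    moreover have "0 \<in> W" using a garding_cone_esym_pos[OF r] by (auto simp: W_def f_def less_imp_le)
    ultimately have "1 / a \<in> W" using a by auto
    from cone[OF this] a show ?thesis by (simp add: schur)
  qed
  moreover have "r \<in> garding_cone k \<and> F k R > 0" if a: "a > 0" and c: "schur_complement R \<in> garding_cone k"
  proof
    have "r = (\<lambda>i j. schur_complement R i j + ((1 / sqrt a) *\<^sub>R x)$i * ((1 / sqrt a) *\<^sub>R x)$j)"
      using a by (simp add: schur fun_eq_iff field_simps)
    then show "r \<in> garding_cone k"
      using garding_cone_add_rank_one(1)[OF c k(2), of "(1 / sqrt a) *\<^sub>R x"] by simp
    show "F k R > 0"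
      using F_eq_schur_complement[OF sym k] garding_cone_esym_pos[OF c] a by (simp add: a_def)
  qed
  ultimately show ?thesis
    using sym Gamma_plus_iff_garding_cone[OF transpose_blk_r[OF sym]] by (auto simp: S_set_def r_def a_def)
qed (simp add: S_set_def)

lemma S_set_scale:
  fixes R :: "real^('n::finite option)^('n option)"
  assumes k: "1 \<le> k" "k \<le> CARD('n)" and R: "R \<in> S_set k" and t: "t > 0"
  shows "t *\<^sub>R R \<in> S_set k" and "F k (t *\<^sub>R R) = t ^ (k + 1) * F k R"
proof -
  have R': "transpose R = R" "R $ None $ None > 0" "schur_complement R \<in> garding_cone k"
    using R S_set_iff[OF k] by auto
  have "transpose (t *\<^sub>R R) = t *\<^sub>R transpose R" by (simp add: transpose_def vec_eq_iff)
  then have sym: "transpose (t *\<^sub>R R) = t *\<^sub>R R" using R' by simp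
  have schur: "schur_complement (t *\<^sub>R R) = (\<lambda>i j. t * schur_complement R i j)"
    using t by (simp add: fun_eq_iff schur_complement_def right_diff_distrib)
  show "t *\<^sub>R R \<in> S_set k"
    using R' t sym garding_cone_scale[OF R'(3) t] by (simp add: S_set_iff[OF k] schur)
  show "F k (t *\<^sub>R R) = t ^ (k + 1) * F k R"
    using F_eq_schur_complement[OF sym k] F_eq_schur_complement[OF R'(1) k] R'(2) t
    by (simp add: schur esym_scale)
qed

lemma S_set_superadditive:
  fixes R R' :: "real^('n::finite option)^('n option)"
  assumes k: "1 \<le> k" "k \<le> CARD('n)" and R: "R \<in> S_set k" and R': "R' \<in> S_set k"
  shows "R + R' \<in> S_set k"
    and "F k (R + R') powr (1 / (real k + 1)) \<ge> F k R powr (1 / (real k + 1)) + F k R' powr (1 / (real k + 1))"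
proof -
  define a where "a = R $ None $ None"
  define b where "b = R' $ None $ None"
  define A where "A = schur_complement R"
  define B where "B = schur_complement R'"
  \<comment> \<open>Completing the square: the outer product of \<open>v\<close> with itself is the
    excess of the two separate quotients over the quotient for the sum.\<close>
  define v where "v = sqrt (a * b / (a + b)) *\<^sub>R ((1 / a) *\<^sub>R blk_x R - (1 / b) *\<^sub>R blk_x R')"
  have sym: "transpose R = R" "transpose R' = R'" and a: "a > 0" and b: "b > 0"
    and A: "A \<in> garding_cone k" and B: "B \<in> garding_cone k"
    using R R' S_set_iff[OF k] by (auto simp: a_def b_def A_def B_def)
  have "transpose (R + R') = transpose R + transpose R'" by (simp add: transpose_def vec_eq_iff)
  then have sym': "transpose (R + R') = R + R'" using sym by simp
  have schur: "schur_complement (R + R') = (\<lambda>i j. (A i j + B i j) + v$i * v$j)"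
  proof (intro ext)
    fix i j
    define xi where "xi = R $ None $ Some i"
    define xj where "xj = R $ None $ Some j"
    define yi where "yi = R' $ None $ Some i"
    define yj where "yj = R' $ None $ Some j"
    have "v$i = sqrt (a * b / (a + b)) * (xi / a - yi / b)" "v$j = sqrt (a * b / (a + b)) * (xj / a - yj / b)"
      by (simp_all add: v_def blk_x_def xi_def xj_def yi_def yj_def)
    moreover have "sqrt (a * b / (a + b)) * sqrt (a * b / (a + b)) = a * b / (a + b)"
      using a b by (intro real_sqrt_mult_self[THEN trans] abs_of_nonneg) simp
    ultimately have "v$i * v$j = a * b / (a + b) * ((xi / a - yi / b) * (xj / a - yj / b))"
      by (metis mult.assoc mult.left_commute)
    also have "\<dots> = xi * xj / a + yi * yj / b - (xi + yi) * (xj + yj) / (a + b)"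
    proof -
      have "a \<noteq> 0" "b \<noteq> 0" "a + b \<noteq> 0" using a b by auto
      then show ?thesis by (simp add: divide_simps) algebra
    qed
    finally show "schur_complement (R + R') i j = (A i j + B i j) + v$i * v$j"
      by (simp add: schur_complement_def A_def B_def a_def b_def xi_def xj_def yi_def yj_def)
  qed
  have AB: "(\<lambda>i j. A i j + B i j) \<in> garding_cone k" by (rule garding_cone_add[OF A B k(2)])
  show "R + R' \<in> S_set k"
    using sym' a b garding_cone_add_rank_one(1)[OF AB k(2), of v]
    by (simp add: S_set_iff[OF k] schur a_def b_def)
  obtain C where C: "size C = k" "\<forall>c\<in>#C. c > 0" "\<And>s. esym k (\<lambda>i j. A i j + s * B i j) = esym k B * (\<Prod>c\<in>#C. s + c)"
    using garding_cone_pencil_factorization[OF A B k(2)] by blast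
  \<comment> \<open>The corner entries satisfy \<open>a + b = b (1 + a / b)\<close>, so
    \<open>a / b\<close> joins the \<open>k\<close> numbers from the pencil; this accounts for the
    exponent \<open>1 / (k + 1)\<close>.\<close>
  define D where "D = add_mset (a / b) C"
  have D: "D \<noteq> {#}" "\<forall>c\<in>#D. c > 0" "size D = k + 1" using C a b by (auto simp: D_def)
  have FR': "F k R' = b * esym k B"
    using F_eq_schur_complement[OF sym(2) k] b by (simp add: b_def B_def)
  then have FR'_pos: "F k R' > 0" using b garding_cone_esym_pos[OF B] by simp
  have FR: "F k R = F k R' * (\<Prod>c\<in>#D. c)"
    using F_eq_schur_complement[OF sym(1) k] a b C(3)[of 0] by (simp add: FR' a_def A_def D_def)
  have "F k R' * (\<Prod>c\<in>#D. 1 + c) = (a + b) * esym k (\<lambda>i j. A i j + B i j)"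
    using C(3)[of 1] b by (simp add: FR' D_def field_simps)
  also have "\<dots> \<le> (a + b) * esym k (schur_complement (R + R'))"
    using garding_cone_add_rank_one(2)[OF AB k(2), of v] a b by (simp add: schur)
  also have "\<dots> = F k (R + R')"
    using F_eq_schur_complement[OF sym' k] a b by (simp add: a_def b_def)
  finally have FRR: "F k R' * (\<Prod>c\<in>#D. 1 + c) \<le> F k (R + R')" .
  let ?p = "1 / (real k + 1)"
  have p: "1 / real (size D) = ?p" using D by (simp add: add.commute)
  have pos: "(\<Prod>c\<in>#D. c) \<ge> 0" "(\<Prod>c\<in>#D. 1 + c) \<ge> 0"
    using D(2) by (induction D) auto
  have "F k R powr ?p + F k R' powr ?p = F k R' powr ?p * (1 + (\<Prod>c\<in>#D. c) powr ?p)"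
    unfolding FR using FR'_pos pos by (simp add: powr_mult algebra_simps)
  also have "\<dots> \<le> F k R' powr ?p * (\<Prod>c\<in>#D. 1 + c) powr ?p"
    using mahler_inequality_mset[OF D(1,2)] unfolding p by (intro mult_left_mono) auto
  also have "\<dots> = (F k R' * (\<Prod>c\<in>#D. 1 + c)) powr ?p"
    using FR'_pos pos by (simp add: powr_mult)
  also have "\<dots> \<le> F k (R + R') powr ?p"
    using FRR FR'_pos pos by (intro powr_mono2) auto
  finally show "F k (R + R') powr ?p \<ge> F k R powr ?p + F k R' powr ?p" .
qed

text \<open>The root of \<open>F k\<close> is homogeneous of degree one, so superadditivity becomes
  concavity. The logarithm of a positive concave function is concave, and the factor
  \<open>1 / (k + 1)\<close> cancels.\<close>

theorem theorem2p1:
  fixes k :: nat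
  assumes "1 \<le> k" and "k \<le> CARD('n::finite)"
  shows "convex (S_set k :: (real^('n option)^('n option)) set)
    \<and> (\<forall>R \<in> (S_set k :: (real^('n option)^('n option)) set). \<forall>t::real. t > 0 \<longrightarrow> t *\<^sub>R R \<in> S_set k)
    \<and> concave_on (S_set k :: (real^('n option)^('n option)) set) (\<lambda>R. F k R powr (1 / (real k + 1)))
    \<and> concave_on (S_set k :: (real^('n option)^('n option)) set) (\<lambda>R. ln (F k R))"
proof -
  let ?S = "S_set k :: (real^('n option)^('n option)) set"
  let ?p = "1 / (real k + 1)"
  have scale: "F k (t *\<^sub>R R) powr ?p = t * F k R powr ?p" if "R \<in> ?S" "t > 0" for R t
  proof -
    have "F k (t *\<^sub>R R) powr ?p = (t ^ (k + 1)) powr ?p * F k R powr ?p"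
      using S_set_scale(2)[OF assms that] that by (simp add: powr_mult S_set_def)
    also have "(t ^ (k + 1)) powr ?p = t"
    proof -
      have "t ^ (k + 1) = t powr (real k + 1)" using powr_realpow[OF that(2), of "k + 1"] by (simp add: add.commute)
      then show ?thesis using that(2) by (simp add: powr_powr)
    qed
    finally show ?thesis .
  qed
  have comb: "u *\<^sub>R x + v *\<^sub>R y \<in> ?S \<and> F k (u *\<^sub>R x + v *\<^sub>R y) powr ?p \<ge> u * F k x powr ?p + v * F k y powr ?p"
    if "x \<in> ?S" "y \<in> ?S" "u \<ge> 0" "v \<ge> 0" "u + v = 1" for x y u v
  \<comment> \<open>Zero weights are separated because \<open>S_set k\<close> does not contain the
    zero matrix and is only closed under positive scaling.\<close>
  proof (cases "u = 0 \<or> v = 0")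
    case True
    then show ?thesis using that by auto
  next
    case False
    then have uv: "u > 0" "v > 0" using that by auto
    have S: "u *\<^sub>R x \<in> ?S" "v *\<^sub>R y \<in> ?S"
      using S_set_scale(1)[OF assms] that uv by auto
    show ?thesis
      using S_set_superadditive[OF assms S] scale[OF that(1) uv(1)] scale[OF that(2) uv(2)] by simp
  qed
  then have conv: "convex ?S" by (simp add: convex_def)
  have "u * ln (F k x) + v * ln (F k y) \<le> ln (F k (u *\<^sub>R x + v *\<^sub>R y))"
    if xy: "x \<in> ?S" "y \<in> ?S" and uv: "u \<ge> 0" "v \<ge> 0" "u + v = 1" for x y u v
  proof -
    have pos: "F k x > 0" "F k y > 0" "F k (u *\<^sub>R x + v *\<^sub>R y) > 0"
      using xy comb[OF xy uv] by (auto simp: S_set_def)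
    have concave: "u * ln X + v * ln Y \<le> ln (u * X + v * Y)" if "X > 0" "Y > 0" for X Y :: real
      using ln_concave that uv by (auto simp: concave_on_iff)
    have "?p * (u * ln (F k x) + v * ln (F k y)) = u * ln (F k x powr ?p) + v * ln (F k y powr ?p)"
      using pos by (simp add: ln_powr algebra_simps)
    also have "\<dots> \<le> ln (u * F k x powr ?p + v * F k y powr ?p)"
      by (rule concave) (use pos in auto)
    also have "\<dots> \<le> ln (F k (u *\<^sub>R x + v *\<^sub>R y) powr ?p)"
    proof (rule ln_mono)
      have "u > 0 \<or> v > 0" using uv by linarith
      then show "0 < u * F k x powr ?p + v * F k y powr ?p"
        using pos uv by (auto intro: add_pos_nonneg add_nonneg_pos)
    qed (use comb[OF xy uv] in simp)
    also have "\<dots> = ?p * ln (F k (u *\<^sub>R x + v *\<^sub>R y))"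
      using pos by (simp add: ln_powr)
    finally show ?thesis by (simp add: divide_le_cancel)
  qed
  then show ?thesis
    using conv comb S_set_scale(1)[OF assms] by (auto simp: concave_on_iff)
qed

end
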